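(* For all integers $a,b\ge 0$, $$T(a,b)=\sum_{k=1}^{a+b+1}(-1)^{k+1}\left(\binom{2k}{2a+1}+\binom{2k}{2b+1}\left(1-\frac{1}{2^{2k}}\right)\right)\frac{1}{2^{2k}}\,T(a+b+1-k)\,\zeta(2k+1).$$
   Context: For positive integers $k_1,\dots,k_r$ with $k_r>1$, the multiple $t$-value is $$t(k_1,\dots,k_r)=\sum_{1\le n_1<n_2<\cdots<n_r}\frac{1}{(2n_1-1)^{k_1}(2n_2-1)^{k_2}\cdots(2n_r-1)^{k_r}}$$ (sum over integers). For integers $n,a,b\ge 0$ put $$T(n)=t(\underbrace{2,\dots,2}_{n}),\qquad T(a,b)=t(\underbrace{2,\dots,2}_{a},3,\underbrace{2,\dots,2}_{b}),$$ with $T(0)=1$. Here $\zeta$ is the Riemann zeta function, and binomial coefficients $\binom{m}{j}$ with $j>m\ge 0$ are $0$. *)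

theory Defs
  imports "HOL-Analysis.Analysis"
begin

text \<open>
  The list \<open>ns\<close> is the summation index \<open>(n\<^sub>1, \<dots>, n\<^sub>r)\<close>, so \<open>ks ! (i - 1)\<close> is the exponent
  \<open>k\<^sub>i\<close> and the last entry of \<open>ks\<close> belongs to the largest index. The series converges when all
  entries of \<open>ks\<close> are positive and the last one exceeds 1; for other arguments \<open>infsum\<close> may
  return the value 0 without meaning. For \<open>ks = []\<close> the only index is \<open>[]\<close> and the value is 1.
\<close>

definition mtv :: "nat list \<Rightarrow> real" where
  "mtv ks = (\<Sum>\<^sub>\<infinity>ns\<in>{ns :: nat list. length ns = length ks \<and> sorted_wrt (<) ns \<and> (\<forall>n\<in>set ns. 1 \<le> n)}.
     1 / (\<Prod>i<length ks. (2 * real (ns ! i) - 1) ^ (ks ! i)))"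

definition T1 :: "nat \<Rightarrow> real" where
  "T1 n = mtv (replicate n 2)"

definition T2 :: "nat \<Rightarrow> nat \<Rightarrow> real" where
  "T2 a b = mtv (replicate a 2 @ [3] @ replicate b 2)"

lemma T1_0: "T1 0 = 1"
proof -
  have "{ns :: nat list. length ns = 0 \<and> sorted_wrt (<) ns \<and> (\<forall>n\<in>set ns. 1 \<le> n)} = {[]}"
    by auto
  then show ?thesis
    unfolding T1_def mtv_def by simp
qed

text \<open>The Riemann zeta function on the half-line \<open>s > 1\<close>, where it equals its Dirichlet series.
  No analytic continuation is involved: for \<open>s \<le> 1\<close> the value carries no meaning.\<close>

definition zeta :: "real \<Rightarrow> real" where
  "zeta s = (\<Sum>n. 1 / real (Suc n) powr s)"

end

theory Submission
  imports Defs "HOL-Real_Asymp.Real_Asymp"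
begin

text \<open>
  Both kinds of partial sums in \<open>T(a,b)\<close> are read off from integrals over \<open>[0, \<pi>/2]\<close>. Two
  integrations by parts give a recurrence in \<open>n\<close> for the integral of
  \<open>(\<pi>/2 - x)\<^sup>2\<^sup>b/(2b)! sin\<^sup>2\<^sup>n\<^sup>-\<^sup>1 x\<close>, which telescopes to the tail sums (indices above \<open>n\<close>); at
  \<open>n = 0\<close> this gives \<open>T(n) = (\<pi>/2)\<^sup>2\<^sup>n/(2n)!\<close>. The head sums (indices below \<open>n\<close>) are, up to explicit
  factors, the coefficients of \<open>x\<^sup>2\<^sup>a\<^sup>+\<^sup>1/(2a+1)!\<close> as a power series in \<open>sin x\<close>. Together they yield
  \<open>T(a,b) = \<integral> x\<^sup>2\<^sup>a\<^sup>+\<^sup>1/(2a+1)! \<cdot> (\<pi>/2 - x)\<^sup>2\<^sup>b\<^sup>+\<^sup>1/(2b+1)! \<cdot> cot x dx\<close>. Expanding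
  \<open>cot x = 2 \<Sum>\<^sub>k sin (2kx)\<close>, with the remainder controlled by the Riemann--Lebesgue lemma, and
  integrating the polynomial by parts produces \<open>\<zeta>(2j+1)\<close> from the endpoint \<open>0\<close> and its alternating
  analogue \<open>(1 - 2\<^sup>-\<^sup>2\<^sup>j) \<zeta>(2j+1)\<close> from \<open>\<pi>/2\<close>.
\<close>

section \<open>Sums over increasing lists\<close>

definition weight :: "nat list \<Rightarrow> real" where
  "weight ns = (\<Prod>n\<leftarrow>ns. 1 / (2 * real n - 1)\<^sup>2)"

definition lists_above :: "nat \<Rightarrow> nat \<Rightarrow> nat list set" where
  "lists_above n r = {ns. length ns = r \<and> sorted_wrt (<) ns \<and> (\<forall>k\<in>set ns. n < k)}"

definition lists_below :: "nat \<Rightarrow> nat \<Rightarrow> nat list set" where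
  "lists_below n r = {ns. length ns = r \<and> sorted_wrt (<) ns \<and> (\<forall>k\<in>set ns. 1 \<le> k \<and> k < n)}"

definition head_sum :: "nat \<Rightarrow> nat \<Rightarrow> real" where
  "head_sum a n = (\<Sum>ns\<in>lists_below n a. weight ns)"

lemma weight_simps [simp]:
  "weight [] = 1"
  "weight (n # ns) = weight ns / (2 * real n - 1)\<^sup>2"
  "weight (ns @ ms) = weight ns * weight ms"
  by (simp_all add: weight_def)

lemma weight_nonneg: "0 \<le> weight ns"
  by (induction ns) auto

lemma finite_lists_below: "finite (lists_below n r)"
  by (rule finite_subset[OF _ finite_lists_length_eq[of "{..<n}" r]])
    (auto simp: lists_below_def)

lemma mtv_term_eq:
  assumes "length ns = length ks"
  shows "(\<Prod>i<length ks. (2 * real (ns ! i) - 1) ^ (ks ! i))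
    = prod_list (map2 (\<lambda>n k. (2 * real n - 1) ^ k) ns ks)"
  using assms
  by (induction ns ks rule: list_induct2) (simp_all add: prod.lessThan_Suc_shift del: prod.lessThan_Suc)

lemma weight_eq_prod_list:
  "1 / prod_list (map2 (\<lambda>n k. (2 * real n - 1) ^ k) ns (replicate (length ns) 2)) = weight ns"
  by (induction ns) (simp_all add: divide_inverse)

lemma head_sum_0 [simp]: "head_sum 0 n = 1"
proof -
  have "lists_below n 0 = {[]}"
    by (auto simp: lists_below_def)
  then show ?thesis
    by (simp add: head_sum_def)
qed

lemma head_sum_Suc_1 [simp]: "head_sum (Suc a) (Suc 0) = 0"
proof -
  have "lists_below (Suc 0) (Suc a) = {}"
    by (auto simp: lists_below_def length_Suc_conv)
  then show ?thesis
    by (simp add: head_sum_def)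
qed

text \<open>Raising the bound admits the single new index \<open>n\<close>, which is either absent
  or the last entry of the list.\<close>

lemma head_sum_Suc_Suc:
  assumes "1 \<le> n"
  shows "head_sum (Suc a) (Suc n) = head_sum (Suc a) n + head_sum a n / (2 * real n - 1)\<^sup>2"
proof -
  have eq: "lists_below (Suc n) (Suc a) = lists_below n (Suc a) \<union> (\<lambda>ns. ns @ [n]) ` lists_below n a"
    (is "?L = ?R")
  proof
    show "?L \<subseteq> ?R"
    proof
      fix ns assume ns: "ns \<in> ?L"
      then have "ns \<noteq> []"
        by (auto simp: lists_below_def)
      then obtain ms k where ns_eq: "ns = ms @ [k]"
        by (metis rev_exhaust)
      show "ns \<in> ?R"
        using ns assms unfolding ns_eq
        by (cases "k = n") (auto simp: lists_below_def sorted_wrt_append image_iff)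
    qed
  next
    show "?R \<subseteq> ?L"
      using assms by (fastforce simp: lists_below_def sorted_wrt_append)
  qed
  have "lists_below n (Suc a) \<inter> (\<lambda>ns. ns @ [n]) ` lists_below n a = {}"
    by (auto simp: lists_below_def)
  moreover have "inj_on (\<lambda>ns. ns @ [n]) (lists_below n a)"
    by (auto simp: inj_on_def)
  ultimately show ?thesis
    unfolding head_sum_def eq
    by (simp add: sum.union_disjoint finite_lists_below sum.reindex sum_divide_distrib)
qed

lemma head_sum_nonneg: "0 \<le> head_sum a n"
  unfolding head_sum_def by (intro sum_nonneg weight_nonneg)

text \<open>A crude bound is enough: it only has to lose against the geometric factor
  \<open>sin X ^ (2 * N + 1)\<close> in \<open>sin_rest_uniform\<close>.\<close>

lemma head_sum_le_power: "1 \<le> n \<Longrightarrow> head_sum a n \<le> real n ^ a"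
proof (induction n arbitrary: a rule: dec_induct)
  case base
  then show ?case by (cases a) auto
next
  case (step n)
  show ?case
  proof (cases a)
    case (Suc a')
    have "head_sum a' n / (2 * real n - 1)\<^sup>2 \<le> head_sum a' n / 1"
      using step.hyps by (intro divide_left_mono head_sum_nonneg) (auto simp: one_le_power)
    also have "\<dots> \<le> real n ^ a'"
      using step.IH by simp
    finally have "head_sum a (Suc n) \<le> real n ^ Suc a' + real n ^ a'"
      using step.hyps step.IH[of a] by (simp add: Suc head_sum_Suc_Suc)
    also have "\<dots> = real (Suc n) * real n ^ a'"
      by (simp add: algebra_simps)
    also have "\<dots> \<le> real (Suc n) * real (Suc n) ^ a'"
      by (intro mult_left_mono power_mono) auto
    finally show ?thesis
      by (simp add: Suc)
  qed simp
qed

text \<open>Splitting off the smallest entry \<open>m\<close> leaves a list above \<open>m\<close>,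
  so the sum over lists is an iterated sum; nonnegativity of the weights justifies the
  rearrangement. Keeping \<open>s\<close> abstract reduces all tail sums to exhibiting one family
  with the right recurrence, later \<open>tail_value\<close>.\<close>

lemma has_sum_weight_lists_above:
  fixes s :: "nat \<Rightarrow> nat \<Rightarrow> real"
  assumes base: "\<And>n. s 0 n = 1"
    and step: "\<And>b n. ((\<lambda>m. s b m / (2 * real m - 1)\<^sup>2) has_sum s (Suc b) n) {n<..}"
  shows "(weight has_sum s b n) (lists_above n b)"
proof (induction b arbitrary: n)
  case 0
  have "lists_above n 0 = {[]}"
    by (auto simp: lists_above_def)
  then show ?case
    using has_sum_finite[of "{[]}" weight] by (simp add: base)
next
  case (Suc b)
  let ?S = "Sigma {n<..} (\<lambda>m. lists_above m b)" and ?f = "\<lambda>(m, ns). m # ns"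
  have eq: "lists_above n (Suc b) = ?f ` ?S"
    by (fastforce simp: lists_above_def length_Suc_conv image_iff)
  have inner: "((\<lambda>ns. (weight \<circ> ?f) (m, ns)) has_sum s b m / (2 * real m - 1)\<^sup>2) (lists_above m b)" for m
    using has_sum_cmult_left[OF Suc.IH[of m], of "1 / (2 * real m - 1)\<^sup>2"] by simp
  have "(weight \<circ> ?f) summable_on ?S"
    by (rule summable_on_SigmaI[OF inner])
      (use has_sum_imp_summable[OF step] in \<open>auto simp: weight_nonneg\<close>)
  then have "((weight \<circ> ?f) has_sum s (Suc b) n) ?S"
    by (rule has_sum_SigmaI[OF inner step])
  then show ?case
    unfolding eq by (subst has_sum_reindex) (auto simp: inj_on_def)
qed

lemma T1_eq:
  fixes s :: "nat \<Rightarrow> nat \<Rightarrow> real"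
  assumes base: "\<And>n. s 0 n = 1"
    and step: "\<And>b n. ((\<lambda>m. s b m / (2 * real m - 1)\<^sup>2) has_sum s (Suc b) n) {n<..}"
  shows "T1 b = s b 0"
proof -
  have eq: "{ns. length ns = length (replicate b 2) \<and> sorted_wrt (<) ns \<and> (\<forall>n\<in>set ns. 1 \<le> n)}
      = lists_above 0 b"
    by (auto simp: lists_above_def Suc_le_eq)
  have "T1 b = infsum weight (lists_above 0 b)"
    unfolding T1_def mtv_def eq
  proof (rule infsum_cong)
    fix ns assume "ns \<in> lists_above 0 b"
    then have "length ns = b"
      by (simp add: lists_above_def)
    then show "1 / (\<Prod>i<length (replicate b 2). (2 * real (ns ! i) - 1) ^ (replicate b 2 ! i)) = weight ns"
      using mtv_term_eq[of ns "replicate b 2"] weight_eq_prod_list[of ns] by simp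
  qed
  also have "\<dots> = s b 0"
    using has_sum_weight_lists_above[of s 0 b, OF base step] by (rule infsumI)
  finally show ?thesis .
qed

text \<open>Each index list is cut at position \<open>a\<close>, the place of the exponent 3. For a
  fixed middle entry \<open>m\<close> the part before it contributes the finite sum
  \<open>head_sum a m\<close> and the part after it the tail sum \<open>s b m\<close>, independently
  of each other.\<close>

lemma T2_eq:
  fixes s :: "nat \<Rightarrow> nat \<Rightarrow> real"
  assumes base: "\<And>n. s 0 n = 1"
    and step: "\<And>b n. ((\<lambda>m. s b m / (2 * real m - 1)\<^sup>2) has_sum s (Suc b) n) {n<..}"
    and total: "((\<lambda>m. head_sum a m * s b m / (2 * real m - 1) ^ 3) has_sum S) {0<..}"
  shows "T2 a b = S"
proof -
  define ks :: "nat list" where "ks = replicate a 2 @ [3] @ replicate b 2"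
  define f :: "nat list \<Rightarrow> real" where "f = (\<lambda>ns. 1 / (\<Prod>i<length ks. (2 * real (ns ! i) - 1) ^ (ks ! i)))"
  let ?S = "Sigma {0<..} (\<lambda>m. lists_below m a \<times> lists_above m b)"
  let ?g = "\<lambda>(m, ns, ms). weight ns * weight ms / (2 * real m - 1) ^ 3"
  let ?L = "{ns :: nat list. length ns = length ks \<and> sorted_wrt (<) ns \<and> (\<forall>n\<in>set ns. 1 \<le> n)}"
  have f_eq: "f (ns @ m # ms) = weight ns * weight ms / (2 * real m - 1) ^ 3"
    if "length ns = a" "length ms = b" for ns ms m
  proof -
    have "f (ns @ m # ms) = 1 / prod_list (map2 (\<lambda>n k. (2 * real n - 1) ^ k) (ns @ m # ms) ks)"
      unfolding f_def using that by (subst mtv_term_eq) (auto simp: ks_def)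
    also have "\<dots> = (1 / prod_list (map2 (\<lambda>n k. (2 * real n - 1) ^ k) ns (replicate (length ns) 2)))
        * (1 / prod_list (map2 (\<lambda>n k. (2 * real n - 1) ^ k) ms (replicate (length ms) 2)))
        / (2 * real m - 1) ^ 3"
      using that by (simp add: ks_def)
    also have "\<dots> = weight ns * weight ms / (2 * real m - 1) ^ 3"
      by (simp only: weight_eq_prod_list)
    finally show ?thesis .
  qed
  have inner: "((\<lambda>y. ?g (m, y)) has_sum head_sum a m * s b m / (2 * real m - 1) ^ 3)
      (lists_below m a \<times> lists_above m b)" if "0 < m" for m
  proof -
    have 1: "((\<lambda>ms. ?g (m, ns, ms)) has_sum weight ns * s b m / (2 * real m - 1) ^ 3) (lists_above m b)" for ns
      using has_sum_cmult_right[OF has_sum_weight_lists_above[of s m b, OF base step],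
          of "weight ns / (2 * real m - 1) ^ 3"]
      by (simp add: field_simps)
    have 2: "((\<lambda>ns. weight ns * s b m / (2 * real m - 1) ^ 3) has_sum
        head_sum a m * s b m / (2 * real m - 1) ^ 3) (lists_below m a)"
      using has_sum_finite[OF finite_lists_below, of "\<lambda>ns. weight ns * s b m / (2 * real m - 1) ^ 3" m a]
      by (simp add: head_sum_def sum_divide_distrib sum_distrib_right)
    have "(\<lambda>y. ?g (m, y)) summable_on (lists_below m a \<times> lists_above m b)"
      by (rule summable_on_SigmaI[OF 1 has_sum_imp_summable[OF 2]])
        (use \<open>0 < m\<close> in \<open>auto simp: weight_nonneg\<close>)
    from has_sum_SigmaI[OF 1 2 this] show ?thesis .
  qed
  have "?g summable_on ?S"
    by (rule summable_on_SigmaI[OF inner has_sum_imp_summable[OF total]])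
      (auto simp: weight_nonneg)
  from has_sum_SigmaI[OF inner total this] have "(?g has_sum S) ?S"
    by auto
  also have "(?g has_sum S) ?S \<longleftrightarrow> (f has_sum S) ?L"
  proof (rule has_sum_reindex_bij_witness
      [where j = "\<lambda>(m, ns, ms). ns @ m # ms" and i = "\<lambda>ns. (ns ! a, take a ns, drop (Suc a) ns)"])
    fix ns assume ns: "ns \<in> ?L"
    then have split: "take a ns @ ns ! a # drop (Suc a) ns = ns"
      by (intro id_take_nth_drop[symmetric]) (simp add: ks_def)
    then show "(case (ns ! a, take a ns, drop (Suc a) ns) of (m, ns, ms) \<Rightarrow> ns @ m # ms) = ns"
      by simp
    have "sorted_wrt (<) (take a ns @ ns ! a # drop (Suc a) ns)"
      "\<forall>n\<in>set (take a ns @ ns ! a # drop (Suc a) ns). 1 \<le> n"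
      using ns by (simp_all only: split) auto
    then show "(ns ! a, take a ns, drop (Suc a) ns) \<in> ?S"
      using ns nth_mem[of a ns]
      by (auto simp: ks_def lists_below_def lists_above_def sorted_wrt_append Suc_le_eq)
  next
    fix y assume "y \<in> ?S"
    then show "(case y of (m, ns, ms) \<Rightarrow> ns @ m # ms) \<in> ?L"
      by (fastforce simp: ks_def lists_below_def lists_above_def sorted_wrt_append)
  qed (auto simp: lists_below_def lists_above_def f_eq nth_append)
  finally have "(f has_sum S) ?L" .
  \<comment> \<open>The \<open>has_sum\<close> fact includes convergence, so this is the genuine
    value and not the default 0 of \<open>infsum\<close>.\<close>
  then have "infsum f ?L = S"
    by (rule infsumI)
  then show ?thesis
    unfolding T2_def mtv_def f_def ks_def .
qed

section \<open>Moments of powers of the sine and the tail sums\<close>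

text \<open>Divided powers of the complementary angle: with the factorial included, differentiation
  only lowers the index and changes the sign, which keeps the integrations by parts free of
  constants.\<close>

definition codiv :: "nat \<Rightarrow> real \<Rightarrow> real" where
  "codiv q x = (pi / 2 - x) ^ q / fact q"

lemma codiv_0 [simp]: "codiv 0 x = 1"
  by (simp add: codiv_def)

lemma codiv_pi_half [simp]: "codiv (Suc q) (pi / 2) = 0"
  by (simp add: codiv_def)

lemma codiv_nonneg: "x \<in> {0..pi / 2} \<Longrightarrow> 0 \<le> codiv q x"
  by (simp add: codiv_def)

lemma DERIV_codiv:
  "(codiv (Suc q) has_real_derivative - codiv q x) (at x within S)"
  unfolding codiv_def by (rule derivative_eq_intros refl | simp)+

lemma continuous_on_codiv [continuous_intros]: "continuous_on S (codiv q)"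
  unfolding codiv_def by (intro continuous_intros) auto

lemma has_integral_derivative_pi_half:
  assumes "\<And>x. x \<in> {0..pi / 2} \<Longrightarrow> (F has_real_derivative f x) (at x within {0..pi / 2})"
  shows "(f has_integral F (pi / 2) - F 0) {0..pi / 2}"
  using assms
  by (intro fundamental_theorem_of_calculus) (auto simp: has_real_derivative_iff_has_vector_derivative)

definition sin_moment :: "nat \<Rightarrow> nat \<Rightarrow> real" where
  "sin_moment b k = integral {0..pi / 2} (\<lambda>x. codiv (2 * b) x * sin x ^ k)"

lemma has_integral_sin_moment:
  "((\<lambda>x. codiv (2 * b) x * sin x ^ k) has_integral sin_moment b k) {0..pi / 2}"
  unfolding sin_moment_def
  by (intro integrable_integral integrable_continuous_real continuous_intros)

text \<open>This is the recurrence \<open>sin_moment_Suc_Suc\<close> formally at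
  \<open>k = -1\<close>. The factor \<open>k + 1\<close> kills the right-hand side there, but the
  boundary term at 0 now survives because it carries \<open>cos 0\<close> and no power of
  \<open>sin 0\<close>.\<close>

lemma sin_moment_1:
  "sin_moment (Suc b) 1 + sin_moment b 1 = codiv (2 * Suc b) 0"
proof -
  define F where "F = (\<lambda>x. codiv (Suc (Suc (2 * b))) x * cos x + codiv (Suc (2 * b)) x * sin x)"
  have "((\<lambda>x. - (codiv (Suc (Suc (2 * b))) x * sin x + codiv (2 * b) x * sin x))
      has_integral F (pi / 2) - F 0) {0..pi / 2}"
    unfolding F_def
    by (rule has_integral_derivative_pi_half)
      (rule derivative_eq_intros DERIV_codiv refl | simp add: algebra_simps)+
  moreover have "((\<lambda>x. - (codiv (Suc (Suc (2 * b))) x * sin x + codiv (2 * b) x * sin x))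
      has_integral - (sin_moment (Suc b) 1 + sin_moment b 1)) {0..pi / 2}"
    using has_integral_neg[OF has_integral_add[OF has_integral_sin_moment[of "Suc b" 1] has_integral_sin_moment[of b 1]]]
    by simp
  ultimately have "F (pi / 2) - F 0 = - (sin_moment (Suc b) 1 + sin_moment b 1)"
    by (rule has_integral_unique)
  then show ?thesis
    by (simp add: F_def)
qed

text \<open>Two integrations by parts move both derivatives from \<open>sin x ^ (k + 2)\<close> to
  the divided power. They are packed into one antiderivative \<open>F = u v' - u' v\<close> with
  \<open>u = codiv (2 * b + 2)\<close> and \<open>v = sin x ^ (k + 2)\<close>; it vanishes at 0
  through the sine and at pi/2 through \<open>codiv\<close>.\<close>

lemma sin_moment_Suc_Suc:
  "(real k + 2)\<^sup>2 * sin_moment (Suc b) (k + 2) + sin_moment b (k + 2)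
    = (real k + 2) * (real k + 1) * sin_moment (Suc b) k"
proof -
  define F where "F = (\<lambda>x. codiv (Suc (Suc (2 * b))) x * ((real k + 2) * sin x ^ (k + 1) * cos x)
    + codiv (Suc (2 * b)) x * sin x ^ (k + 2))"
  define f where "f = (\<lambda>x. (real k + 2) * (real k + 1) * (codiv (2 * Suc b) x * sin x ^ k)
    - (real k + 2)\<^sup>2 * (codiv (2 * Suc b) x * sin x ^ (k + 2)) - codiv (2 * b) x * sin x ^ (k + 2))"
  have "(f has_integral F (pi / 2) - F 0) {0..pi / 2}"
  proof (rule has_integral_derivative_pi_half)
    fix x :: real
    have c: "cos x * cos x = 1 - sin x * sin x"
      using sin_cos_squared_add[of x] by (simp add: power2_eq_square)
    have "(F has_real_derivative
        - codiv (Suc (2 * b)) x * ((real k + 2) * sin x ^ (k + 1) * cos x)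
        + codiv (Suc (Suc (2 * b))) x *
          ((real k + 2) * ((real k + 1) * sin x ^ k * (cos x * cos x) - sin x ^ (k + 1) * sin x))
        + (- codiv (2 * b) x * sin x ^ (k + 2)
          + codiv (Suc (2 * b)) x * ((real k + 2) * sin x ^ (k + 1) * cos x))) (at x within {0..pi / 2})"
      unfolding F_def
      by (rule derivative_eq_intros DERIV_codiv refl)+ (simp add: algebra_simps)
    then show "(F has_real_derivative f x) (at x within {0..pi / 2})"
      unfolding c f_def by (rule DERIV_cong) (simp add: algebra_simps power2_eq_square)
  qed
  moreover have "(f has_integral (real k + 2) * (real k + 1) * sin_moment (Suc b) k
      - (real k + 2)\<^sup>2 * sin_moment (Suc b) (k + 2) - sin_moment b (k + 2)) {0..pi / 2}"
    unfolding f_def by (intro has_integral_diff has_integral_mult_right has_integral_sin_moment)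
  ultimately have "F (pi / 2) - F 0 = (real k + 2) * (real k + 1) * sin_moment (Suc b) k
      - (real k + 2)\<^sup>2 * sin_moment (Suc b) (k + 2) - sin_moment b (k + 2)"
    by (rule has_integral_unique)
  then show ?thesis
    by (simp add: F_def)
qed

lemma sin_moment_0_1: "sin_moment 0 1 = 1"
proof -
  have "((\<lambda>x. codiv (2 * 0) x * sin x ^ 1) has_integral - cos (pi / 2) - - cos 0) {0..pi / 2}"
    by (rule has_integral_derivative_pi_half) (rule derivative_eq_intros refl | simp)+
  with has_integral_sin_moment[of 0 1] show ?thesis
    by (simp add: has_integral_unique)
qed

text \<open>The Wallis recurrence, from the antiderivative \<open>sin x ^ (k + 1) * cos x\<close>,
  which is 0 at both endpoints.\<close>

lemma sin_moment_0_Suc_Suc: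
  "(real k + 2) * sin_moment 0 (k + 2) = (real k + 1) * sin_moment 0 k"
proof -
  define F where "F = (\<lambda>x :: real. sin x ^ (k + 1) * cos x)"
  define f where "f = (\<lambda>x. (real k + 1) * (codiv (2 * 0) x * sin x ^ k)
    - (real k + 2) * (codiv (2 * 0) x * sin x ^ (k + 2)))"
  have "(f has_integral F (pi / 2) - F 0) {0..pi / 2}"
  proof (rule has_integral_derivative_pi_half)
    fix x :: real
    have c: "cos x * cos x = 1 - sin x * sin x"
      using sin_cos_squared_add[of x] by (simp add: power2_eq_square)
    have "(F has_real_derivative (real k + 1) * sin x ^ k * (cos x * cos x) - sin x ^ (k + 1) * sin x)
        (at x within {0..pi / 2})"
      unfolding F_def
      by (rule derivative_eq_intros refl)+ (simp add: algebra_simps)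
    then show "(F has_real_derivative f x) (at x within {0..pi / 2})"
      unfolding c f_def by (rule DERIV_cong) (simp add: algebra_simps)
  qed
  moreover have "(f has_integral (real k + 1) * sin_moment 0 k - (real k + 2) * sin_moment 0 (k + 2)) {0..pi / 2}"
    unfolding f_def by (intro has_integral_diff has_integral_mult_right has_integral_sin_moment)
  ultimately have "F (pi / 2) - F 0 = (real k + 1) * sin_moment 0 k - (real k + 2) * sin_moment 0 (k + 2)"
    by (rule has_integral_unique)
  then show ?thesis
    by (simp add: F_def)
qed

lemma sin_moment_nonneg: "0 \<le> sin_moment b k"
  by (rule has_integral_nonneg[OF has_integral_sin_moment])
    (auto intro!: mult_nonneg_nonneg codiv_nonneg zero_le_power sin_ge_zero)

section \<open>The function x / sin x, continuously differentiable up to 0\<close>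

definition inv_sinc :: "real \<Rightarrow> real" where
  "inv_sinc x = (if x = 0 then 1 else x / sin x)"

definition inv_sinc' :: "real \<Rightarrow> real" where
  "inv_sinc' x = (if x = 0 then 0 else (sin x - x * cos x) / (sin x)\<^sup>2)"

lemma sin_nonzero: "x \<in> {0..pi / 2} \<Longrightarrow> x \<noteq> 0 \<Longrightarrow> sin x \<noteq> 0" for x :: real
  using sin_gt_zero[of x] pi_gt_zero by auto

lemma inv_sinc_times_sin: "x \<in> {0..pi / 2} \<Longrightarrow> inv_sinc x * sin x = x"
  using sin_nonzero[of x] by (auto simp: inv_sinc_def)

text \<open>The derivative at the removable singularity 0 is what makes \<open>cot_kernel\<close>
  continuously differentiable on the closed interval, as the Riemann--Lebesgue argument
  requires.\<close>

lemma DERIV_inv_sinc: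
  assumes "x \<in> {0..pi / 2}"
  shows "(inv_sinc has_real_derivative inv_sinc' x) (at x within {0..pi / 2})"
proof (cases "x = 0")
  case True
  have "((\<lambda>y :: real. (y / sin y - 1) / y) \<longlongrightarrow> 0) (at 0)"
    by real_asymp
  moreover have "\<forall>\<^sub>F y in at 0. (y / sin y - 1) / y = (inv_sinc y - inv_sinc 0) / (y - 0)"
    by (auto simp: eventually_at_filter inv_sinc_def)
  ultimately have "(inv_sinc has_real_derivative 0) (at 0)"
    unfolding has_field_derivative_iff by (rule Lim_transform_eventually)
  then show ?thesis
    using True by (simp add: inv_sinc'_def has_field_derivative_at_within)
next
  case False
  have "((\<lambda>x. x / sin x) has_real_derivative inv_sinc' x) (at x)"
    using sin_nonzero[OF assms False] False
    by (auto intro!: derivative_eq_intros simp: inv_sinc'_def power2_eq_square)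
  moreover have "\<forall>\<^sub>F y in nhds x. y / sin y = inv_sinc y"
    using t1_space_nhds[OF False] by eventually_elim (simp add: inv_sinc_def)
  ultimately have "(inv_sinc has_real_derivative inv_sinc' x) (at x)"
    by (subst (asm) DERIV_cong_ev[OF refl _ refl])
  then show ?thesis
    by (rule has_field_derivative_at_within)
qed

lemma continuous_on_inv_sinc: "continuous_on {0..pi / 2} inv_sinc"
  by (rule DERIV_continuous_on[OF DERIV_inv_sinc])

lemma continuous_on_inv_sinc': "continuous_on {0..pi / 2} inv_sinc'"
  unfolding continuous_on_def
proof
  fix x :: real assume x: "x \<in> {0..pi / 2}"
  show "(inv_sinc' \<longlongrightarrow> inv_sinc' x) (at x within {0..pi / 2})"
  proof (cases "x = 0")
    case True
    have "((\<lambda>x :: real. (sin x - x * cos x) / (sin x)\<^sup>2) \<longlongrightarrow> 0) (at 0)"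
      by real_asymp
    moreover have "\<forall>\<^sub>F y in at 0. (sin y - y * cos y) / (sin y)\<^sup>2 = inv_sinc' y"
      by (auto simp: eventually_at_filter inv_sinc'_def)
    ultimately have "(inv_sinc' \<longlongrightarrow> 0) (at 0)"
      by (rule Lim_transform_eventually)
    then show ?thesis
      using True by (simp add: inv_sinc'_def tendsto_within_subset[OF _ subset_UNIV])
  next
    case False
    have "((\<lambda>x. (sin x - x * cos x) / (sin x)\<^sup>2) \<longlongrightarrow> inv_sinc' x) (at x)"
      using sin_nonzero[OF x False] False by (auto intro!: tendsto_eq_intros simp: inv_sinc'_def)
    moreover have "\<forall>\<^sub>F y in at x. (sin y - y * cos y) / (sin y)\<^sup>2 = inv_sinc' y"
      using eventually_neq_at_within[of 0 x UNIV] by eventually_elim (simp add: inv_sinc'_def)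
    ultimately have "(inv_sinc' \<longlongrightarrow> inv_sinc' x) (at x)"
      by (rule Lim_transform_eventually)
    then show ?thesis
      by (rule tendsto_within_subset) simp
  qed
qed

section \<open>Wallis products and the evaluation of the tail sums\<close>

definition odd_ratio :: "nat \<Rightarrow> real" where
  "odd_ratio n = (\<Prod>j = 1..<n. (2 * real j + 1) / (2 * real j))"

lemma odd_ratio_1 [simp]: "odd_ratio (Suc 0) = 1"
  by (simp add: odd_ratio_def)

lemma odd_ratio_Suc:
  "1 \<le> n \<Longrightarrow> odd_ratio (Suc n) = odd_ratio n * ((2 * real n + 1) / (2 * real n))"
  by (simp add: odd_ratio_def)

lemma odd_ratio_pos: "0 < odd_ratio n"
  unfolding odd_ratio_def by (intro prod_pos) auto

lemma odd_ratio_le: "1 \<le> n \<Longrightarrow> odd_ratio n \<le> 2 * real n"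
proof (induction n rule: dec_induct)
  case (step n)
  have "odd_ratio (Suc n) \<le> 2 * real n * ((2 * real n + 1) / (2 * real n))"
    unfolding odd_ratio_Suc[OF step.hyps(1)] using step.IH by (intro mult_right_mono) auto
  also have "\<dots> \<le> 2 * real (Suc n)"
    using step.hyps by simp
  finally show ?case .
qed simp

text \<open>For \<open>n > 0\<close> this is the mean of \<open>codiv (2 * b)\<close> under the
  density proportional to \<open>sin x ^ (2 * n - 1)\<close>. For \<open>n = 0\<close> truncated
  subtraction would give the exponent 0 instead of -1, so the value is set to the boundary term of
  \<open>sin_moment_1\<close>.\<close>

definition tail_value :: "nat \<Rightarrow> nat \<Rightarrow> real" where
  "tail_value b n = (if n = 0 then codiv (2 * b) 0 else odd_ratio n * sin_moment b (2 * n - 1))"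

text \<open>Wallis: for \<open>n > 0\<close>, \<open>odd_ratio n\<close> is the reciprocal of the
  integral of \<open>sin x ^ (2 * n - 1)\<close>.\<close>

lemma tail_value_0 [simp]: "tail_value 0 n = 1"
proof (induction n)
  case (Suc n)
  show ?case
  proof (cases "n = 0")
    case False
    have "(2 * real n + 1) * sin_moment 0 (2 * n + 1) = 2 * real n * sin_moment 0 (2 * n - 1)"
      using sin_moment_0_Suc_Suc[of "2 * n - 1"] False by (simp add: of_nat_diff add.commute)
    moreover have "tail_value 0 (Suc n) = odd_ratio n / (2 * real n) * ((2 * real n + 1) * sin_moment 0 (2 * n + 1))"
      using False by (simp add: tail_value_def odd_ratio_Suc)
    ultimately have "tail_value 0 (Suc n) = odd_ratio n / (2 * real n) * (2 * real n * sin_moment 0 (2 * n - 1))"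
      by simp
    also have "\<dots> = 1"
      using Suc False by (simp add: tail_value_def)
    finally show ?thesis .
  qed (use sin_moment_0_1 in \<open>simp add: tail_value_def\<close>)
qed (simp add: tail_value_def)

text \<open>The normalisation by \<open>odd_ratio\<close> turns the coefficients of both moments of
  order \<open>Suc b\<close> in the sine recurrence into 1, so that their difference telescopes in
  \<open>n\<close>.\<close>

lemma tail_value_rec:
  "tail_value (Suc b) n = tail_value (Suc b) (Suc n) + tail_value b (Suc n) / (2 * real n + 1)\<^sup>2"
proof (cases "n = 0")
  case True
  then show ?thesis
    using sin_moment_1[of b] by (simp add: tail_value_def)
next
  case False
  define c where "c = 2 * real n"
  have c: "c > 0"
    using False by (simp add: c_def)
  have *: "(c + 1)\<^sup>2 * sin_moment (Suc b) (2 * n + 1) + sin_moment b (2 * n + 1)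
      = (c + 1) * c * sin_moment (Suc b) (2 * n - 1)"
    using sin_moment_Suc_Suc[of "2 * n - 1" b] False
    by (simp add: of_nat_diff c_def add.commute)
  define R where "R = odd_ratio n * ((c + 1) / c)"
  have tail: "tail_value b' (Suc n) = R * sin_moment b' (2 * n + 1)" for b'
    using False by (simp add: tail_value_def odd_ratio_Suc R_def c_def)
  have "tail_value (Suc b) (Suc n) + tail_value b (Suc n) / (2 * real n + 1)\<^sup>2
      = R / (c + 1)\<^sup>2 * ((c + 1)\<^sup>2 * sin_moment (Suc b) (2 * n + 1) + sin_moment b (2 * n + 1))"
    unfolding tail c_def[symmetric] using c by (simp add: distrib_left)
  also have "\<dots> = odd_ratio n * sin_moment (Suc b) (2 * n - 1)"
    unfolding * R_def using c by (simp add: power2_eq_square)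
  finally show ?thesis
    using False by (simp add: tail_value_def)
qed

lemma tail_value_nonneg: "0 \<le> tail_value b n"
  by (auto simp: tail_value_def codiv_nonneg sin_moment_nonneg less_imp_le[OF odd_ratio_pos])

text \<open>With \<open>y = pi / 2 - x\<close> the claim is that \<open>y / sin y\<close> is
  bounded, which holds by compactness.\<close>

lemma pi_half_minus_le_cos:
  obtains C :: real where "C \<ge> 0" "\<And>x. x \<in> {0..pi / 2} \<Longrightarrow> pi / 2 - x \<le> C * cos x"
proof -
  obtain C where C: "C \<ge> 0" "\<And>x. x \<in> {0..pi / 2} \<Longrightarrow> norm (inv_sinc x) \<le> C"
    using continuous_on_compact_bound[OF compact_Icc continuous_on_inv_sinc] by blast
  show thesis
  proof (rule that[OF C(1)])
    fix x :: real assume x: "x \<in> {0..pi / 2}"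
    then have "pi / 2 - x = inv_sinc (pi / 2 - x) * cos x"
      using inv_sinc_times_sin[of "pi / 2 - x"] by (simp add: sin_diff)
    also have "\<dots> \<le> C * cos x"
      using x C(2)[of "pi / 2 - x"] by (intro mult_right_mono cos_ge_zero) auto
    finally show "pi / 2 - x \<le> C * cos x" .
  qed
qed

text \<open>The density concentrates at pi/2, where the divided power vanishes. Quantitatively,
  \<open>codiv\<close> is dominated by a multiple of \<open>1 - (sin x)\<^sup>2\<close>, whose
  normalised moment is the difference of two Wallis integrals and equals
  \<open>1 / (2 * n + 1)\<close>.\<close>

lemma tail_value_LIMSEQ: "tail_value (Suc b) \<longlonglongrightarrow> 0"
proof -
  obtain C :: real where C: "C \<ge> 0" "\<And>x. x \<in> {0..pi / 2} \<Longrightarrow> pi / 2 - x \<le> C * cos x"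
    using pi_half_minus_le_cos by blast
  \<comment> \<open>Two of the \<open>2 * b + 2\<close> factors \<open>pi / 2 - x\<close> are
    compared with \<open>C * cos x\<close>, the others with \<open>pi / 2\<close>; the factorial is
    dropped.\<close>
  define K where "K = C ^ 2 * (pi / 2) ^ (2 * b)"
  have bound: "codiv (2 * Suc b) x \<le> K * (1 - (sin x)\<^sup>2)" if x: "x \<in> {0..pi / 2}" for x
  proof -
    have "codiv (2 * Suc b) x \<le> (pi / 2 - x) ^ (2 * Suc b)"
      unfolding codiv_def using x frac_le[of "(pi / 2 - x) ^ (2 * Suc b)" "(pi / 2 - x) ^ (2 * Suc b)" 1 "fact (2 * Suc b)"]
        by (simp del: fact_Suc mult_Suc_right power_Suc)
    also have "\<dots> = (pi / 2 - x) ^ 2 * (pi / 2 - x) ^ (2 * b)"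
      by (simp add: power2_eq_square)
    also have "\<dots> \<le> (C * cos x) ^ 2 * (pi / 2) ^ (2 * b)"
      using x C(2)[OF x] by (intro mult_mono power_mono) auto
    also have "\<dots> = K * (1 - (sin x)\<^sup>2)"
      by (simp add: K_def power_mult_distrib cos_squared_eq)
    finally show ?thesis .
  qed
  have le: "tail_value (Suc b) n \<le> K / (2 * real n + 1)" if "1 \<le> n" for n
  proof -
    have "sin_moment (Suc b) (2 * n - 1) \<le> K * (sin_moment 0 (2 * n - 1) - sin_moment 0 (2 * n + 1))"
    proof (rule has_integral_le[OF has_integral_sin_moment])
      show "((\<lambda>x. K * (codiv (2 * 0) x * sin x ^ (2 * n - 1) - codiv (2 * 0) x * sin x ^ (2 * n + 1)))
          has_integral K * (sin_moment 0 (2 * n - 1) - sin_moment 0 (2 * n + 1))) {0..pi / 2}"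
        by (intro has_integral_diff has_integral_mult_right has_integral_sin_moment)
    next
      fix x :: real assume x: "x \<in> {0..pi / 2}"
      have "codiv (2 * Suc b) x * sin x ^ (2 * n - 1) \<le> K * (1 - (sin x)\<^sup>2) * sin x ^ (2 * n - 1)"
        using x by (intro mult_right_mono bound zero_le_power sin_ge_zero) auto
      also have "\<dots> = K * (sin x ^ (2 * n - 1) - sin x ^ (2 + (2 * n - 1)))"
        by (simp only: power_add) (simp add: algebra_simps)
      also have "2 + (2 * n - 1) = 2 * n + 1"
        using that by simp
      finally show "codiv (2 * Suc b) x * sin x ^ (2 * n - 1)
          \<le> K * (codiv (2 * 0) x * sin x ^ (2 * n - 1) - codiv (2 * 0) x * sin x ^ (2 * n + 1))"
        by simp
    qed
    then have "tail_value (Suc b) n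
        \<le> odd_ratio n * (K * (sin_moment 0 (2 * n - 1) - sin_moment 0 (2 * n + 1)))"
      using that odd_ratio_pos[of n] by (simp add: tail_value_def)
    \<comment> \<open>Replacing \<open>odd_ratio n\<close> by \<open>odd_ratio (Suc n)\<close> in
      the second moment costs the factor \<open>2 * n / (2 * n + 1)\<close>; afterwards both moments
      are normalised to 1.\<close>
    also have "\<dots> = K * (tail_value 0 n - tail_value 0 (Suc n) * (2 * real n / (2 * real n + 1)))"
    proof -
      have "odd_ratio n = odd_ratio (Suc n) * (2 * real n / (2 * real n + 1))"
        using that by (simp add: odd_ratio_Suc)
      then have "odd_ratio n * sin_moment 0 (2 * n + 1) = tail_value 0 (Suc n) * (2 * real n / (2 * real n + 1))"
        by (simp add: tail_value_def del: tail_value_0)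
      moreover have "odd_ratio n * sin_moment 0 (2 * n - 1) = tail_value 0 n"
        using that by (simp add: tail_value_def del: tail_value_0)
      ultimately show ?thesis
        by (simp only: right_diff_distrib mult.left_commute[of "odd_ratio n"])
    qed
    also have "\<dots> = K / (2 * real n + 1)"
      by (simp add: field_simps)
    finally show ?thesis .
  qed
  have lim: "(\<lambda>n. K / (2 * real n + 1)) \<longlonglongrightarrow> 0"
    by real_asymp
  show ?thesis
    by (rule tendsto_sandwich[OF _ _ tendsto_const lim])
      (auto intro!: always_eventually eventually_sequentiallyI[of 1] le simp: tail_value_nonneg)
qed

text \<open>Telescoping of \<open>tail_value_rec\<close> with limit 0. Together with
  \<open>tail_value_0\<close> this supplies the hypotheses on \<open>s\<close> in
  \<open>T1_eq\<close> and \<open>T2_eq\<close>.\<close>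

lemma tail_value_has_sum:
  "((\<lambda>m. tail_value b m / (2 * real m - 1)\<^sup>2) has_sum tail_value (Suc b) n) {n<..}"
proof -
  define f where "f = (\<lambda>m. tail_value b m / (2 * real m - 1)\<^sup>2)"
  have f: "f (Suc m) = tail_value (Suc b) m - tail_value (Suc b) (Suc m)" for m
    using tail_value_rec[of b m] by (simp add: f_def)
  have "(\<lambda>i. tail_value (Suc b) (i + n)) \<longlonglongrightarrow> 0"
    using tail_value_LIMSEQ by (rule LIMSEQ_ignore_initial_segment)
  from telescope_sums'[OF this] have "(\<lambda>i. f (Suc (i + n))) sums tail_value (Suc b) n"
    by (simp add: f)
  then have "((\<lambda>i. f (Suc (i + n))) has_sum tail_value (Suc b) n) UNIV"
    by (rule sums_nonneg_imp_has_sum) (simp add: f_def tail_value_nonneg)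
  also have "?this \<longleftrightarrow> (f has_sum tail_value (Suc b) n) {n<..}"
    by (rule has_sum_reindex_bij_witness[of _ "\<lambda>m. m - Suc n" "\<lambda>i. Suc (i + n)"]) auto
  finally show ?thesis
    unfolding f_def .
qed

lemma T1_closed_form: "T1 n = (pi / 2) ^ (2 * n) / fact (2 * n)"
  using T1_eq[of tail_value, OF tail_value_0 tail_value_has_sum]
  by (simp add: tail_value_def codiv_def)

section \<open>Odd powers as power series in the sine\<close>

text \<open>For \<open>a = 0\<close> these are the Taylor coefficients (2n-1)!! / ((2n)!! (2n+1)) of
  arcsin; in general they belong to the expansion of arcsin^(2a+1) / (2a+1)!.\<close>

definition sin_coeff_pow :: "nat \<Rightarrow> nat \<Rightarrow> real" where
  "sin_coeff_pow a n = head_sum a (Suc n) * odd_ratio (Suc n) / (2 * real n + 1)\<^sup>2"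

definition sin_partial :: "nat \<Rightarrow> nat \<Rightarrow> real \<Rightarrow> real" where
  "sin_partial a N x = (\<Sum>n<N. sin_coeff_pow a n * sin x ^ (2 * n + 1))"

lemma sin_coeff_pow_nonneg: "0 \<le> sin_coeff_pow a n"
  unfolding sin_coeff_pow_def
  by (intro divide_nonneg_nonneg mult_nonneg_nonneg head_sum_nonneg less_imp_le[OF odd_ratio_pos]) auto

lemma sin_coeff_pow_at_0: "sin_coeff_pow a 0 = (if a = 0 then 1 else 0)"
  by (cases a) (simp_all add: sin_coeff_pow_def)

text \<open>This is the equation y_a'' = y_(a-1) for y_a = x^(2a+1) / (2a+1)!, read off at
  \<open>sin x ^ (2 * n + 1)\<close>, using (sin^m)'' = m (m-1) sin^(m-2) - m^2 sin^m. It reduces to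
  the recurrence of the head sums.\<close>

lemma sin_coeff_pow_rec:
  "sin_coeff_pow a (Suc n) * ((2 * real n + 3) * (2 * real n + 2)) - sin_coeff_pow a n * (2 * real n + 1)\<^sup>2
    = (case a of 0 \<Rightarrow> 0 | Suc a' \<Rightarrow> sin_coeff_pow a' n)"
proof -
  have "odd_ratio (Suc (Suc n)) = odd_ratio (Suc n) * ((2 * real n + 3) / (2 * real n + 2))"
    using odd_ratio_Suc[of "Suc n"] by (simp add: algebra_simps)
  moreover have "2 * real n + 3 \<noteq> 0" "2 * real n + 2 \<noteq> 0"
    by linarith+
  ultimately have 1: "sin_coeff_pow a (Suc n) * ((2 * real n + 3) * (2 * real n + 2))
      = head_sum a (Suc (Suc n)) * odd_ratio (Suc n)"
    by (simp add: sin_coeff_pow_def power2_eq_square add.commute)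
  have "2 * real n + 1 \<noteq> 0"
    by linarith
  then have 2: "sin_coeff_pow a n * (2 * real n + 1)\<^sup>2 = head_sum a (Suc n) * odd_ratio (Suc n)"
    by (simp add: sin_coeff_pow_def)
  show ?thesis
  proof (cases a)
    case (Suc a')
    then have "head_sum a (Suc (Suc n)) = head_sum a (Suc n) + head_sum a' (Suc n) / (2 * real n + 1)\<^sup>2"
      using head_sum_Suc_Suc[of "Suc n" a'] by (simp add: add.commute)
    then show ?thesis
      unfolding 1 2 by (simp add: Suc sin_coeff_pow_def algebra_simps)
  next
    case 0
    then show ?thesis
      using 1 2 by simp
  qed
qed

lemma sin_coeff_pow_bound: "sin_coeff_pow a n * (2 * real n + 1)\<^sup>2 \<le> 2 * real (Suc n) ^ Suc a"
proof -
  have "2 * real n + 1 \<noteq> 0"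
    by linarith
  then have "sin_coeff_pow a n * (2 * real n + 1)\<^sup>2 = head_sum a (Suc n) * odd_ratio (Suc n)"
    by (simp add: sin_coeff_pow_def)
  also have "\<dots> \<le> real (Suc n) ^ a * (2 * real (Suc n))"
    by (intro mult_mono head_sum_le_power odd_ratio_le less_imp_le[OF odd_ratio_pos]) auto
  also have "\<dots> = 2 * real (Suc n) ^ Suc a"
    by simp
  finally show ?thesis .
qed

text \<open>Applying \<open>d\<^sup>2/dx\<^sup>2\<close> to the partial sum telescopes up to a single boundary term.\<close>

lemma sin_partial_second_derivative:
  "(\<Sum>n<Suc N. sin_coeff_pow a n *
      ((2 * real n + 1) * (2 * real n) * sin x ^ (2 * n - 1) - (2 * real n + 1)\<^sup>2 * sin x ^ (2 * n + 1)))
    = (case a of 0 \<Rightarrow> 0 | Suc a' \<Rightarrow> sin_partial a' N x)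
      - sin_coeff_pow a N * (2 * real N + 1)\<^sup>2 * sin x ^ (2 * N + 1)"
proof (induction N)
  case 0
  then show ?case by (simp add: sin_partial_def split: nat.splits)
next
  case (Suc N)
  let ?c = "case a of 0 \<Rightarrow> 0 | Suc a' \<Rightarrow> sin_partial a' N x"
  have "(\<Sum>n<Suc (Suc N). sin_coeff_pow a n *
      ((2 * real n + 1) * (2 * real n) * sin x ^ (2 * n - 1) - (2 * real n + 1)\<^sup>2 * sin x ^ (2 * n + 1)))
    = ?c + (sin_coeff_pow a (Suc N) * ((2 * real N + 3) * (2 * real N + 2))
        - sin_coeff_pow a N * (2 * real N + 1)\<^sup>2) * sin x ^ (2 * N + 1)
      - sin_coeff_pow a (Suc N) * (2 * real (Suc N) + 1)\<^sup>2 * sin x ^ (2 * Suc N + 1)"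
    by (subst sum.lessThan_Suc, subst Suc.IH) (simp add: algebra_simps)
  also have "\<dots> = ?c + (case a of 0 \<Rightarrow> 0 | Suc a' \<Rightarrow> sin_coeff_pow a' N) * sin x ^ (2 * N + 1)
      - sin_coeff_pow a (Suc N) * (2 * real (Suc N) + 1)\<^sup>2 * sin x ^ (2 * Suc N + 1)"
    unfolding sin_coeff_pow_rec ..
  finally show ?case
    by (simp add: sin_partial_def split: nat.splits)
qed

definition sin_rest :: "nat \<Rightarrow> nat \<Rightarrow> real \<Rightarrow> real" where
  "sin_rest a N x = x ^ (2 * a + 1) / fact (2 * a + 1) - sin_partial a N x"

definition sin_rest' :: "nat \<Rightarrow> nat \<Rightarrow> real \<Rightarrow> real" where
  "sin_rest' a N x = x ^ (2 * a) / fact (2 * a)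
    - (\<Sum>n<N. sin_coeff_pow a n * ((2 * real n + 1) * (sin x ^ (2 * n) * cos x)))"

text \<open>The second derivative of \<open>sin_rest a (Suc N)\<close>, with index \<open>N\<close>:
  the telescoping consumes one term of the partial sum.\<close>

definition sin_rest'' :: "nat \<Rightarrow> nat \<Rightarrow> real \<Rightarrow> real" where
  "sin_rest'' a N x = (case a of 0 \<Rightarrow> 0 | Suc a' \<Rightarrow> sin_rest a' N x)
      + sin_coeff_pow a N * (2 * real N + 1)\<^sup>2 * sin x ^ (2 * N + 1)"

lemma DERIV_power_div_fact:
  "((\<lambda>x. x ^ Suc q / fact (Suc q)) has_real_derivative x ^ q / fact q) (at x)"
  by (rule derivative_eq_intros refl | simp)+

lemma DERIV_sin_rest: "(sin_rest a N has_real_derivative sin_rest' a N x) (at x)"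
proof -
  have 1: "((\<lambda>x. sin_coeff_pow a n * sin x ^ (2 * n + 1)) has_real_derivative
      sin_coeff_pow a n * ((2 * real n + 1) * (sin x ^ (2 * n) * cos x))) (at x)" for n
    by (rule derivative_eq_intros refl | simp)+
  show ?thesis
    unfolding sin_rest_def sin_rest'_def sin_partial_def
    by (intro DERIV_diff DERIV_sum 1) (use DERIV_power_div_fact[of "2 * a"] in simp)
qed

lemma DERIV_sin_rest': "(sin_rest' a (Suc N) has_real_derivative sin_rest'' a N x) (at x)"
proof -
  have c: "cos x * cos x = 1 - sin x * sin x"
    using sin_cos_squared_add[of x] by (simp add: power2_eq_square)
  \<comment> \<open>At \<open>n = 0\<close> the truncated exponent \<open>2 * n - 1\<close> does no
    harm, since its factor \<open>2 * real n\<close> is 0.\<close>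
  have 1: "((\<lambda>x. sin_coeff_pow a n * ((2 * real n + 1) * (sin x ^ (2 * n) * cos x))) has_real_derivative
      sin_coeff_pow a n * ((2 * real n + 1) * (2 * real n) * sin x ^ (2 * n - 1)
        - (2 * real n + 1)\<^sup>2 * sin x ^ (2 * n + 1))) (at x)" for n
  proof -
    have "((\<lambda>x. sin_coeff_pow a n * ((2 * real n + 1) * (sin x ^ (2 * n) * cos x))) has_real_derivative
        sin_coeff_pow a n * ((2 * real n + 1) *
          (2 * real n * sin x ^ (2 * n - 1) * (cos x * cos x) - sin x ^ (2 * n) * sin x))) (at x)"
      by (rule derivative_eq_intros refl | simp)+
    then show ?thesis
      unfolding c by (rule DERIV_cong) (cases n; simp add: algebra_simps power2_eq_square)
  qed
  have 2: "((\<lambda>x. x ^ (2 * a) / fact (2 * a)) has_real_derivative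
      (case a of 0 \<Rightarrow> 0 | Suc a' \<Rightarrow> x ^ (2 * a' + 1) / fact (2 * a' + 1))) (at x)"
  proof (cases a)
    case (Suc a')
    then show ?thesis
      using DERIV_power_div_fact[of "2 * a' + 1" x] by (simp del: fact_Suc power_Suc)
  qed simp
  have "(sin_rest' a (Suc N) has_real_derivative
      (case a of 0 \<Rightarrow> 0 | Suc a' \<Rightarrow> x ^ (2 * a' + 1) / fact (2 * a' + 1))
      - (\<Sum>n<Suc N. sin_coeff_pow a n *
        ((2 * real n + 1) * (2 * real n) * sin x ^ (2 * n - 1) - (2 * real n + 1)\<^sup>2 * sin x ^ (2 * n + 1)))) (at x)"
    unfolding sin_rest'_def by (intro DERIV_diff DERIV_sum 1 2)
  then show ?thesis
    unfolding sin_partial_second_derivative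
    by (rule DERIV_cong) (simp add: sin_rest''_def sin_rest_def split: nat.splits)
qed

text \<open>Induction on \<open>a\<close>: the second derivative of the remainder is the remainder
  for \<open>a - 1\<close> plus one boundary term, and the remainder vanishes to first order at 0,
  so Taylor's formula passes smallness on. The boundary term tends to 0 uniformly because
  \<open>sin X < 1\<close>; hence \<open>X\<close> stays strictly below pi/2.\<close>

lemma sin_rest_uniform:
  assumes X: "0 < X" "X < pi / 2"
  shows "\<exists>\<delta>. \<delta> \<longlonglongrightarrow> 0 \<and> (\<forall>\<^sub>F N in sequentially. \<forall>x\<in>{0..X}. \<bar>sin_rest a N x\<bar> \<le> \<delta> N)"
proof (induction a)
  have q: "0 < sin X" "sin X < 1"
    using X sin_gt_zero[of X] sin_monotone_2pi[of X "pi / 2"] by auto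
  \<comment> \<open>The polynomial bound on the coefficient times the largest possible power of the
    sine: it dominates the boundary term in \<open>sin_rest''\<close>.\<close>
  define e where "e = (\<lambda>a N. 2 * real (Suc N) ^ Suc a * sin X ^ (2 * N + 1))"
  have e_lim: "e a \<longlonglongrightarrow> 0" for a
    unfolding e_def using q by real_asymp
  have e_bound: "sin_coeff_pow a N * (2 * real N + 1)\<^sup>2 * sin t ^ (2 * N + 1) \<le> e a N"
    if t: "t \<in> {0..X}" for a N t
  proof -
    have "0 \<le> sin t" "sin t \<le> sin X"
      using t X by (auto intro!: sin_ge_zero sin_monotone_2pi_le)
    then show ?thesis
      unfolding e_def
      by (intro mult_mono sin_coeff_pow_bound power_mono mult_nonneg_nonneg) auto
  qed
  have step: "\<bar>sin_rest a (Suc N) x\<bar> \<le> X\<^sup>2 * (\<delta> + e a N)"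
    if x: "x \<in> {0..X}" and \<delta>: "\<And>t. t \<in> {0..X} \<Longrightarrow> \<bar>case a of 0 \<Rightarrow> 0 | Suc a' \<Rightarrow> sin_rest a' N t\<bar> \<le> \<delta>"
    for a N x \<delta>
  proof (cases "x = 0")
    case True
    have "0 \<le> \<delta>" "0 \<le> e a N"
      using \<delta>[OF x] q by (auto simp: e_def)
    then show ?thesis
      using True by (simp add: sin_rest_def sin_partial_def)
  next
    case False
    \<comment> \<open>The derivatives of orders 0, 1 and 2 in the format of Maclaurin's formula with
      Lagrange remainder.\<close>
    define diff where "diff = (\<lambda>m :: nat. if m = 0 then sin_rest a (Suc N)
      else if m = 1 then sin_rest' a (Suc N) else sin_rest'' a N)"
    have "\<exists>t. 0 < t \<and> t \<le> x \<and> sin_rest a (Suc N) x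
        = (\<Sum>m<2. diff m 0 / fact m * x ^ m) + diff 2 t / fact 2 * x ^ 2"
      using x False
      by (intro Maclaurin2) (auto simp: diff_def less_2_cases_iff DERIV_sin_rest DERIV_sin_rest')
    then obtain t where t: "0 < t" "t \<le> x"
      and eq: "sin_rest a (Suc N) x = (\<Sum>m<2. diff m 0 / fact m * x ^ m) + diff 2 t / fact 2 * x ^ 2"
      by blast
    \<comment> \<open>At 0 only the term \<open>n = 0\<close> survives. It is 1 exactly when
      \<open>a = 0\<close>, and so cancels \<open>0 ^ (2 * a) / fact (2 * a)\<close>.\<close>
    have "(\<Sum>n<Suc N. sin_coeff_pow a n * ((2 * real n + 1) * (sin 0 ^ (2 * n) * cos 0)))
        = (if a = 0 then 1 else 0)"
      by (subst sum.lessThan_Suc_shift) (simp add: sin_coeff_pow_at_0)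
    then have "sin_rest' a (Suc N) 0 = 0"
      by (cases a) (simp_all add: sin_rest'_def del: sum.lessThan_Suc)
    moreover have "sin_rest a (Suc N) 0 = 0"
      by (simp add: sin_rest_def sin_partial_def)
    ultimately have eq': "sin_rest a (Suc N) x = sin_rest'' a N t / 2 * x\<^sup>2"
      using eq by (simp add: diff_def numeral_2_eq_2)
    have tX: "t \<in> {0..X}"
      using t x by auto
    have "0 \<le> sin_coeff_pow a N * (2 * real N + 1)\<^sup>2 * sin t ^ (2 * N + 1)"
      using tX X by (intro mult_nonneg_nonneg sin_coeff_pow_nonneg zero_le_power sin_ge_zero) auto
    then have "\<bar>sin_rest'' a N t\<bar> \<le> \<delta> + e a N"
      using \<delta>[OF tX] e_bound[OF tX, of a N] unfolding sin_rest''_def by linarith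
    then have "\<bar>sin_rest a (Suc N) x\<bar> \<le> (\<delta> + e a N) * x\<^sup>2"
      unfolding eq' abs_mult by (intro mult_mono) auto
    also have "\<dots> \<le> (\<delta> + e a N) * X\<^sup>2"
      using x \<open>\<bar>sin_rest'' a N t\<bar> \<le> \<delta> + e a N\<close>
      by (intro mult_left_mono power_mono) auto
    finally show ?thesis
      by (simp add: mult.commute)
  qed
  {
    case 0
    show ?case
    proof (intro exI conjI)
      \<comment> \<open>The estimate \<open>step\<close> concerns \<open>Suc N\<close>, hence the
        shift to \<open>N - 1\<close>; the value at \<open>N = 0\<close> does not affect the
        limit.\<close>
      show "(\<lambda>N. X\<^sup>2 * (0 + e 0 (N - 1))) \<longlonglongrightarrow> 0"
        by (subst filterlim_sequentially_Suc[symmetric])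
          (use tendsto_mult_left[OF e_lim[of 0], of "X\<^sup>2"] in simp)
      show "\<forall>\<^sub>F N in sequentially. \<forall>x\<in>{0..X}. \<bar>sin_rest 0 N x\<bar> \<le> X\<^sup>2 * (0 + e 0 (N - 1))"
      proof (subst eventually_sequentially_Suc[symmetric], intro always_eventually allI ballI)
        fix N x assume "x \<in> {0..X}"
        then show "\<bar>sin_rest 0 (Suc N) x\<bar> \<le> X\<^sup>2 * (0 + e 0 (Suc N - 1))"
          unfolding diff_Suc_1 by (rule step) simp
      qed
    qed
  next
    case (Suc a)
    then obtain \<delta> where \<delta>: "\<delta> \<longlonglongrightarrow> 0"
      "\<forall>\<^sub>F N in sequentially. \<forall>x\<in>{0..X}. \<bar>sin_rest a N x\<bar> \<le> \<delta> N"
      by blast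
    show ?case
    proof (intro exI conjI)
      show "(\<lambda>N. X\<^sup>2 * (\<delta> (N - 1) + e (Suc a) (N - 1))) \<longlonglongrightarrow> 0"
        by (subst filterlim_sequentially_Suc[symmetric])
          (use tendsto_mult_left[OF tendsto_add[OF \<delta>(1) e_lim[of "Suc a"]], of "X\<^sup>2"] in simp)
      have "\<forall>\<^sub>F N in sequentially. \<forall>x\<in>{0..X}. \<bar>sin_rest (Suc a) (Suc N) x\<bar> \<le> X\<^sup>2 * (\<delta> N + e (Suc a) N)"
        using \<delta>(2) by eventually_elim (intro ballI step, auto)
      then show "\<forall>\<^sub>F N in sequentially. \<forall>x\<in>{0..X}. \<bar>sin_rest (Suc a) N x\<bar>
          \<le> X\<^sup>2 * (\<delta> (N - 1) + e (Suc a) (N - 1))"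
        by (subst eventually_sequentially_Suc[symmetric]) simp
    qed
  }
qed

lemma sin_power_series:
  assumes "0 \<le> x" "x < pi / 2"
  shows "(\<lambda>n. sin_coeff_pow a n * sin x ^ (2 * n + 1)) sums (x ^ (2 * a + 1) / fact (2 * a + 1))"
proof (cases "x = 0")
  case False
  obtain \<delta> where \<delta>: "\<delta> \<longlonglongrightarrow> 0" "\<forall>\<^sub>F N in sequentially. \<forall>y\<in>{0..x}. \<bar>sin_rest a N y\<bar> \<le> \<delta> N"
    using sin_rest_uniform[of x a] assms False by auto
  have "\<forall>\<^sub>F N in sequentially. norm (sin_rest a N x) \<le> \<delta> N"
    using \<delta>(2) by eventually_elim (use assms in auto)
  then have "(\<lambda>N. sin_rest a N x) \<longlonglongrightarrow> 0"
    using \<delta>(1) by (rule Lim_null_comparison)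
  then have "(\<lambda>N. x ^ (2 * a + 1) / fact (2 * a + 1) - sin_rest a N x) \<longlonglongrightarrow> x ^ (2 * a + 1) / fact (2 * a + 1) - 0"
    by (intro tendsto_intros)
  then show ?thesis
    by (simp add: sums_def sin_rest_def sin_partial_def)
qed simp

text \<open>Away from \<open>0\<close> this is \<open>codiv (2 * b + 1) x * (x ^ (2 * a + 1) / fact (2 * a + 1)) / sin x\<close>; writing it
  with \<open>inv_sinc\<close> makes it continuously differentiable up to \<open>0\<close>.\<close>

definition cot_kernel :: "nat \<Rightarrow> nat \<Rightarrow> real \<Rightarrow> real" where
  "cot_kernel a b x = codiv (2 * b + 1) x * (x ^ (2 * a) / fact (2 * a + 1) * inv_sinc x)"

lemma continuous_on_cot_kernel: "continuous_on {0..pi / 2} (cot_kernel a b)"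
  unfolding cot_kernel_def by (intro continuous_intros continuous_on_inv_sinc) auto

text \<open>In the interior this is the sine series multiplied by \<open>codiv * cos / sin\<close>.
  At 0 only the constant term remains, and at pi/2 the factor \<open>cos x\<close> annihilates every
  term, so convergence of the sine series at \<open>sin x = 1\<close> is never invoked.\<close>

lemma sin_power_series':
  assumes "x \<in> {0..pi / 2}"
  shows "(\<lambda>n. sin_coeff_pow a n * (codiv (2 * b + 1) x * (cos x * sin x ^ (2 * n))))
    sums (cot_kernel a b x * cos x)"
proof -
  consider "x = 0" | "x = pi / 2" | "0 < x" "x < pi / 2"
    using assms by fastforce
  then show ?thesis
  proof cases
    case 1
    have "(\<lambda>n. sin_coeff_pow a n * (codiv (2 * b + 1) x * (cos x * sin x ^ (2 * n))))
        sums (\<Sum>n\<in>{0}. sin_coeff_pow a n * (codiv (2 * b + 1) x * (cos x * sin x ^ (2 * n))))"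
      using 1 by (intro sums_finite) auto
    then show ?thesis
      using 1 by (cases "a = 0") (simp_all add: cot_kernel_def inv_sinc_def sin_coeff_pow_at_0 power_0_left)
  next
    case 2
    then have "cos x = 0"
      by (simp only: cos_pi_half)
    then show ?thesis
      by simp
  next
    case 3
    then have s: "sin x > 0"
      by (intro sin_gt_zero) auto
    have "(\<lambda>n. sin_coeff_pow a n * sin x ^ (2 * n + 1) * (codiv (2 * b + 1) x * cos x / sin x))
        sums (x ^ (2 * a + 1) / fact (2 * a + 1) * (codiv (2 * b + 1) x * cos x / sin x))"
      using 3 by (intro sums_mult2 sin_power_series) auto
    moreover have "sin_coeff_pow a n * sin x ^ (2 * n + 1) * (codiv (2 * b + 1) x * cos x / sin x)
        = sin_coeff_pow a n * (codiv (2 * b + 1) x * (cos x * sin x ^ (2 * n)))" for n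
      using s by simp
    moreover have "x ^ (2 * a + 1) / fact (2 * a + 1) * (codiv (2 * b + 1) x * cos x / sin x)
        = cot_kernel a b x * cos x"
      using 3 s by (simp add: cot_kernel_def inv_sinc_def del: fact_Suc)
    ultimately show ?thesis
      by simp
  qed
qed

text \<open>Integration by parts with antiderivative
  \<open>sin x ^ (2 * n + 1) / (2 * n + 1)\<close>. The new denominator joins the square in
  \<open>sin_coeff_pow\<close> to form the cube that the exponent 3 demands.\<close>

lemma has_integral_codiv_cos_sin:
  "((\<lambda>x. codiv (2 * b + 1) x * (cos x * sin x ^ (2 * n))) has_integral
    sin_moment b (2 * n + 1) / (2 * real n + 1)) {0..pi / 2}"
proof -
  define F where "F = (\<lambda>x. codiv (Suc (2 * b)) x * sin x ^ (2 * n + 1) / (2 * real n + 1))"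
  have nz: "2 * real n + 1 \<noteq> 0"
    by linarith
  have "((\<lambda>x. codiv (2 * b + 1) x * (cos x * sin x ^ (2 * n))
      - codiv (2 * b) x * sin x ^ (2 * n + 1) / (2 * real n + 1)) has_integral F (pi / 2) - F 0) {0..pi / 2}"
  proof (rule has_integral_derivative_pi_half)
    fix x :: real
    have "(F has_real_derivative (- codiv (2 * b) x * sin x ^ (2 * n + 1)
        + codiv (Suc (2 * b)) x * ((2 * real n + 1) * sin x ^ (2 * n) * cos x)) / (2 * real n + 1))
        (at x within {0..pi / 2})"
      unfolding F_def by (rule derivative_eq_intros DERIV_codiv refl | simp)+
    then show "(F has_real_derivative codiv (2 * b + 1) x * (cos x * sin x ^ (2 * n))
      - codiv (2 * b) x * sin x ^ (2 * n + 1) / (2 * real n + 1)) (at x within {0..pi / 2})"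
      by (rule DERIV_cong) (use nz in \<open>simp add: divide_simps algebra_simps\<close>)
  qed
  from has_integral_add[OF this has_integral_divide[OF has_integral_sin_moment[of b "2 * n + 1"], of "2 * real n + 1"]]
  show ?thesis
    by (simp add: F_def)
qed

text \<open>Termwise integration of the sine series. All terms are nonnegative, so the partial sums
  are dominated by their continuous limit.\<close>

lemma T2_integral: "T2 a b = integral {0..pi / 2} (\<lambda>x. cot_kernel a b x * cos x)"
proof (rule T2_eq[of tail_value, OF tail_value_0 tail_value_has_sum])
  define summand where "summand = (\<lambda>n x. sin_coeff_pow a n * (codiv (2 * b + 1) x * (cos x * sin x ^ (2 * n))))"
  define f where "f = (\<lambda>N x. \<Sum>n<N. summand n x)"
  \<comment> \<open>The summand of \<open>T2_eq\<close> at \<open>m = Suc n\<close>, where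
    \<open>2 * m - 1 = 2 * n + 1\<close>.\<close>
  define t where "t = (\<lambda>n. head_sum a (Suc n) * tail_value b (Suc n) / (2 * real n + 1) ^ 3)"
  have summand_int: "(summand n has_integral t n) {0..pi / 2}" for n
  proof -
    have "(summand n has_integral sin_coeff_pow a n * (sin_moment b (2 * n + 1) / (2 * real n + 1))) {0..pi / 2}"
      unfolding summand_def by (intro has_integral_mult_right has_integral_codiv_cos_sin)
    also have "sin_coeff_pow a n * (sin_moment b (2 * n + 1) / (2 * real n + 1)) = t n"
      by (simp add: t_def sin_coeff_pow_def tail_value_def power3_eq_cube power2_eq_square)
    finally show ?thesis .
  qed
  have summand_nonneg: "0 \<le> summand n x" if "x \<in> {0..pi / 2}" for n x
    unfolding summand_def using that
    by (intro mult_nonneg_nonneg sin_coeff_pow_nonneg codiv_nonneg cos_ge_zero zero_le_power sin_ge_zero) auto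
  have f_int: "(f N has_integral (\<Sum>n<N. t n)) {0..pi / 2}" for N
    unfolding f_def by (intro has_integral_sum summand_int) auto
  have lim: "(\<lambda>n. summand n x) sums (cot_kernel a b x * cos x)" if "x \<in> {0..pi / 2}" for x
    unfolding summand_def using that by (rule sin_power_series')
  have "(\<lambda>N. integral {0..pi / 2} (f N)) \<longlonglongrightarrow> integral {0..pi / 2} (\<lambda>x. cot_kernel a b x * cos x)"
  proof (rule dominated_convergence(2)[where h = "\<lambda>x. cot_kernel a b x * cos x"])
    show "f N integrable_on {0..pi / 2}" for N
      using f_int by blast
    show "(\<lambda>x. cot_kernel a b x * cos x) integrable_on {0..pi / 2}"
      by (intro integrable_continuous_real continuous_intros continuous_on_cot_kernel)
    fix x :: real assume x: "x \<in> {0..pi / 2}"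
    show "(\<lambda>N. f N x) \<longlonglongrightarrow> cot_kernel a b x * cos x"
      using lim[OF x] by (simp add: sums_def f_def)
    show "norm (f N x) \<le> cot_kernel a b x * cos x" for N
    proof -
      have "f N x \<le> (\<Sum>n. summand n x)"
        unfolding f_def by (intro sum_le_suminf sums_summable[OF lim[OF x]] summand_nonneg x) auto
      moreover have "0 \<le> f N x"
        unfolding f_def by (intro sum_nonneg summand_nonneg x)
      ultimately show ?thesis
        using sums_unique[OF lim[OF x]] by simp
    qed
  qed
  then have "t sums integral {0..pi / 2} (\<lambda>x. cot_kernel a b x * cos x)"
    by (simp add: sums_def integral_unique[OF f_int])
  then have "(t has_sum integral {0..pi / 2} (\<lambda>x. cot_kernel a b x * cos x)) UNIV"
    by (rule sums_nonneg_imp_has_sum) (simp add: t_def head_sum_nonneg tail_value_nonneg)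
  also have "?this \<longleftrightarrow> ((\<lambda>m. head_sum a m * tail_value b m / (2 * real m - 1) ^ 3) has_sum
      integral {0..pi / 2} (\<lambda>x. cot_kernel a b x * cos x)) {0<..}"
    by (rule has_sum_reindex_bij_witness[of _ "\<lambda>m. m - 1" Suc]) (auto simp: t_def add.commute)
  finally show "((\<lambda>m. head_sum a m * tail_value b m / (2 * real m - 1) ^ 3) has_sum
      integral {0..pi / 2} (\<lambda>x. cot_kernel a b x * cos x)) {0<..}" .
qed

section \<open>The Fourier expansion of the cotangent\<close>

text \<open>One integration by parts against \<open>sin (L * x) / L\<close> gains a factor
  \<open>1 / L\<close>; what remains is the boundary term at pi/2 and the integral of
  \<open>p'\<close>, both bounded uniformly in \<open>N\<close> and collected in
  \<open>K\<close>.\<close>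

lemma cos_integral_tendsto_0:
  fixes p p' :: "real \<Rightarrow> real"
  assumes deriv: "\<And>x. x \<in> {0..pi / 2} \<Longrightarrow> (p has_real_derivative p' x) (at x within {0..pi / 2})"
    and cont: "continuous_on {0..pi / 2} p'"
  shows "(\<lambda>N. integral {0..pi / 2} (\<lambda>x. p x * cos ((2 * real N + 1) * x))) \<longlonglongrightarrow> 0"
proof -
  obtain M where M: "M \<ge> 0" "\<And>x. x \<in> {0..pi / 2} \<Longrightarrow> norm (p' x) \<le> M"
    using continuous_on_compact_bound[OF compact_Icc cont] by blast
  define K where "K = \<bar>p (pi / 2)\<bar> + M * (pi / 2)"
  have bound: "norm (integral {0..pi / 2} (\<lambda>x. p x * cos ((2 * real N + 1) * x))) \<le> K / (2 * real N + 1)" for N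
  proof -
    define L where "L = 2 * real N + 1"
    have L: "L > 0"
      by (simp add: L_def add_nonneg_pos)
    define R where "R = integral {0..pi / 2} (\<lambda>x. p' x * sin (L * x))"
    have p'_int: "((\<lambda>x. p' x * sin (L * x)) has_integral R) {0..pi / 2}"
      unfolding R_def by (intro integrable_integral integrable_continuous_real continuous_intros cont)
    have "((\<lambda>x. p' x * sin (L * x) / L + p x * cos (L * x)) has_integral
        p (pi / 2) * sin (L * (pi / 2)) / L - p 0 * sin (L * 0) / L) {0..pi / 2}"
      by (rule has_integral_derivative_pi_half)
        (use L in \<open>auto intro!: derivative_eq_intros deriv simp: field_simps\<close>)
    from has_integral_diff[OF this has_integral_divide[OF p'_int, of L]]
    have "integral {0..pi / 2} (\<lambda>x. p x * cos (L * x)) = (p (pi / 2) * sin (L * (pi / 2)) - R) / L"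
      by (simp add: integral_unique diff_divide_distrib)
    moreover have "\<bar>p (pi / 2) * sin (L * (pi / 2))\<bar> \<le> \<bar>p (pi / 2)\<bar>"
      by (simp add: abs_mult mult_left_le)
    moreover have "\<bar>R\<bar> \<le> M * (pi / 2)"
    proof -
      have "norm R \<le> M * measure lborel (cbox 0 (pi / 2))"
      proof (rule has_integral_bound[OF M(1)])
        show "((\<lambda>x. p' x * sin (L * x)) has_integral R) (cbox 0 (pi / 2))"
          using p'_int by simp
        fix x assume "x \<in> cbox 0 (pi / 2)"
        then show "norm (p' x * sin (L * x)) \<le> M"
          using mult_mono[OF M(2)[of x] abs_sin_le_one[of "L * x"] M(1)] by (simp add: abs_mult)
      qed
      then show ?thesis
        by simp
    qed
    ultimately show ?thesis
      using L unfolding L_def[symmetric] K_def by (simp add: divide_right_mono)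
  qed
  have "(\<lambda>N. K / (2 * real N + 1)) \<longlonglongrightarrow> 0"
    by real_asymp
  then show ?thesis
    by (rule Lim_null_comparison[OF always_eventually, rotated]) (use bound in auto)
qed

lemma cot_kernel_cos_tendsto_0:
  "(\<lambda>N. integral {0..pi / 2} (\<lambda>x. cot_kernel a b x * cos ((2 * real N + 1) * x))) \<longlonglongrightarrow> 0"
proof (rule cos_integral_tendsto_0)
  \<comment> \<open>The product rule; for \<open>a = 0\<close> the factor
    \<open>real (2 * a)\<close> removes the term with the truncated exponent.\<close>
  define k' where "k' = (\<lambda>x. - codiv (2 * b) x * (x ^ (2 * a) / fact (2 * a + 1) * inv_sinc x)
    + codiv (2 * b + 1) x * (real (2 * a) * x ^ (2 * a - 1) / fact (2 * a + 1) * inv_sinc x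
      + x ^ (2 * a) / fact (2 * a + 1) * inv_sinc' x))"
  show "continuous_on {0..pi / 2} k'"
    unfolding k'_def
    by (intro continuous_intros continuous_on_inv_sinc continuous_on_inv_sinc') auto
  fix x :: real assume x: "x \<in> {0..pi / 2}"
  show "(cot_kernel a b has_real_derivative k' x) (at x within {0..pi / 2})"
    unfolding cot_kernel_def k'_def Suc_eq_plus1[symmetric]
    by (rule derivative_eq_intros DERIV_codiv DERIV_inv_sinc[OF x] refl | simp)+
qed

text \<open>The finite form of cot x = 2 (sin 2x + sin 4x + ...): after division by
  \<open>sin x\<close> the remainder is \<open>cos ((2 * N + 1) * x) / sin x\<close>.\<close>

lemma sin_times_sum_sin:
  "sin x * (\<Sum>k = 1..N. 2 * sin (2 * real k * x)) = cos x - cos ((2 * real N + 1) * x)"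
proof (induction N)
  case (Suc N)
  have "sin x * (2 * sin (2 * real (Suc N) * x))
      = cos (2 * real (Suc N) * x - x) - cos (2 * real (Suc N) * x + x)"
    by (simp add: cos_diff cos_add)
  also have "\<dots> = cos ((2 * real N + 1) * x) - cos ((2 * real (Suc N) + 1) * x)"
    by (simp add: algebra_simps)
  finally show ?case
    using Suc by (simp add: distrib_left)
qed simp

text \<open>Each induction step integrates by parts twice. Since \<open>sin (2 * k * x)\<close>
  vanishes at 0 and pi/2, only derivatives of even order appear at the endpoints, and
  \<open>cos (k * pi)\<close> gives the sign at pi/2.\<close>

lemma has_integral_poly_sin:
  assumes "0 < k" and "(pderiv ^^ (2 * d)) P = 0"
  shows "((\<lambda>x. poly P x * sin (2 * real k * x)) has_integral
    (\<Sum>j<d. (- 1) ^ j * (poly ((pderiv ^^ (2 * j)) P) 0 - (- 1) ^ k * poly ((pderiv ^^ (2 * j)) P) (pi / 2))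
      / (2 * real k) ^ (2 * j + 1))) {0..pi / 2}"
  using assms(2)
proof (induction d arbitrary: P)
  case (Suc d)
  define Q where "Q = pderiv (pderiv P)"
  define m where "m = 2 * real k"
  have m: "m > 0"
    using assms by (simp add: m_def)
  have Q: "(pderiv ^^ (2 * Suc j)) P = (pderiv ^^ (2 * j)) Q" for j
    by (simp add: Q_def funpow_swap1)
  let ?t = "\<lambda>P j. (- 1) ^ j * (poly ((pderiv ^^ (2 * j)) P) 0 - (- 1) ^ k * poly ((pderiv ^^ (2 * j)) P) (pi / 2))
      / m ^ (2 * j + 1)"
  have IH: "((\<lambda>x. poly Q x * sin (m * x)) has_integral (\<Sum>j<d. ?t Q j)) {0..pi / 2}"
    using Suc.IH[of Q] Suc.prems unfolding Q m_def by simp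
  define F where "F = (\<lambda>x. poly (pderiv P) x * sin (m * x) / m\<^sup>2 - poly P x * cos (m * x) / m)"
  have "((\<lambda>x. poly P x * sin (m * x) + poly Q x * sin (m * x) / m\<^sup>2) has_integral F (pi / 2) - F 0) {0..pi / 2}"
    unfolding F_def Q_def
    by (rule has_integral_derivative_pi_half)
      (use m in \<open>auto intro!: derivative_eq_intros simp: power2_eq_square field_simps\<close>)
  from has_integral_diff[OF this has_integral_divide[OF IH, of "m\<^sup>2"]]
  have "((\<lambda>x. poly P x * sin (m * x)) has_integral F (pi / 2) - F 0 - (\<Sum>j<d. ?t Q j) / m\<^sup>2) {0..pi / 2}"
    by simp
  also have "F (pi / 2) - F 0 = ?t P 0"
  proof -
    have "sin (m * (pi / 2)) = 0" "cos (m * (pi / 2)) = (- 1) ^ k"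
      by (simp_all add: m_def sin_npi cos_npi mult.commute)
    then show ?thesis
      by (simp add: F_def diff_divide_distrib algebra_simps)
  qed
  also have "(\<Sum>j<d. ?t Q j) / m\<^sup>2 = - (\<Sum>j<d. ?t P (Suc j))"
    unfolding Q sum_divide_distrib sum_negf[symmetric]
    by (rule sum.cong) (simp_all add: power2_eq_square mult_ac)
  also have "?t P 0 - - (\<Sum>j<d. ?t P (Suc j)) = (\<Sum>j<Suc d. ?t P j)"
    unfolding sum.lessThan_Suc_shift by simp
  finally show ?case
    unfolding m_def .
qed simp

section \<open>Endpoint derivatives of the numerator polynomial\<close>

definition numer :: "nat \<Rightarrow> nat \<Rightarrow> real poly" where
  "numer a b = smult (1 / (fact (2 * a + 1) * fact (2 * b + 1)))
    (monom 1 (2 * a + 1) * [:pi / 2, - 1:] ^ (2 * b + 1))"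

lemma poly_numer: "x \<in> {0..pi / 2} \<Longrightarrow> poly (numer a b) x = cot_kernel a b x * sin x"
proof -
  assume x: "x \<in> {0..pi / 2}"
  have lin: "poly [:pi / 2, - 1:] x = pi / 2 - x"
    by simp
  have "cot_kernel a b x * sin x = codiv (2 * b + 1) x * (x ^ (2 * a) / fact (2 * a + 1) * (inv_sinc x * sin x))"
    by (simp only: cot_kernel_def mult_ac)
  also have "\<dots> = codiv (2 * b + 1) x * (x ^ (2 * a + 1) / fact (2 * a + 1))"
    by (simp only: inv_sinc_times_sin[OF x] power_add power_one_right times_divide_eq_left)
  also have "\<dots> = poly (numer a b) x"
    unfolding numer_def poly_smult poly_mult poly_monom poly_power lin codiv_def
    by (simp add: mult.commute del: fact_Suc power_Suc)
  finally show ?thesis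
    by (rule sym)
qed

text \<open>The reflection \<open>x -> pi / 2 - x\<close> swaps the two linear factors. Derivatives
  at pi/2 thus become derivatives at 0 with \<open>a\<close> and \<open>b\<close> exchanged, which
  is where the two binomials of the formula come from.\<close>

lemma numer_reflect: "pcompose (numer a b) [:pi / 2, - 1:] = numer b a"
proof -
  have "poly (pcompose (numer a b) [:pi / 2, - 1:]) = poly (numer b a)"
    by (rule ext) (simp add: numer_def poly_pcompose poly_monom mult_ac del: fact_Suc power_Suc mult_Suc_right)
  then show ?thesis
    by (simp only: poly_eq_poly_eq_iff)
qed

text \<open>Each differentiation yields a factor -1 by the chain rule; for even order the signs
  cancel.\<close>

lemma higher_pderiv_reflect:
  "(pderiv ^^ (2 * j)) (pcompose P [:c, - 1:]) = pcompose ((pderiv ^^ (2 * j)) P) [:c, - 1:]"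
  for P :: "real poly"
proof -
  have "pderiv (pderiv (pcompose P [:c, - 1:])) = pcompose (pderiv (pderiv P)) [:c, - 1:]" for P :: "real poly"
    by (simp add: pderiv_pcompose pderiv_mult pderiv_pCons pderiv_minus)
  then show ?thesis
    by (induction j) simp_all
qed

lemma poly_higher_pderiv_0: "poly ((pderiv ^^ n) P) 0 = fact n * coeff P n" for P :: "real poly"
  by (simp add: poly_0_coeff_0 coeff_higher_pderiv pochhammer_fact)

text \<open>By the binomial theorem the coefficient contains (pi/2)^(2r) / (2r)! with
  \<open>r = a + b + 1 - j\<close>, which is \<open>T1 r\<close> by its closed form. The minus sign
  arises because \<open>2 * j - (2 * a + 1)\<close> is odd.\<close>

lemma coeff_numer:
  assumes "j \<le> a + b + 1"
  shows "fact (2 * j) * coeff (numer a b) (2 * j)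
    = - (real ((2 * j) choose (2 * a + 1)) * T1 (a + b + 1 - j))"
proof (cases "2 * a + 1 \<le> 2 * j")
  case True
  define i where "i = 2 * j - (2 * a + 1)"
  have i: "2 * j = 2 * a + 1 + i" "i \<le> 2 * b + 1" "odd i"
    using True assms unfolding i_def by presburger+
  have "coeff (numer a b) (2 * j)
      = 1 / (fact (2 * a + 1) * fact (2 * b + 1)) * coeff ([:pi / 2, - 1:] ^ (2 * b + 1)) i"
    using True unfolding numer_def coeff_smult coeff_monom_mult i_def
    by (simp only: not_less[symmetric] if_False mult_1_left)
  also have "coeff ([:pi / 2, - 1:] ^ (2 * b + 1)) i
      = real ((2 * b + 1) choose i) * (- 1) ^ i * (pi / 2) ^ (2 * b + 1 - i)"
    by (rule coeff_linear_poly_power[OF i(2)])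
  also have "real ((2 * b + 1) choose i) = fact (2 * b + 1) / (fact i * fact (2 * b + 1 - i))"
    using i(2) by (rule binomial_fact)
  finally have "fact (2 * j) * coeff (numer a b) (2 * j)
      = - (fact (2 * j) / (fact (2 * a + 1) * fact i) * ((pi / 2) ^ (2 * b + 1 - i) / fact (2 * b + 1 - i)))"
    using i(3) by (simp del: fact_Suc)
  also have "fact (2 * j) / (fact (2 * a + 1) * fact i) = real ((2 * j) choose (2 * a + 1))"
    using binomial_fact[OF True, where 'a = real] by (simp add: i_def)
  also have "2 * b + 1 - i = 2 * (a + b + 1 - j)"
    using i assms by simp
  also have "(pi / 2) ^ (2 * (a + b + 1 - j)) / fact (2 * (a + b + 1 - j)) = T1 (a + b + 1 - j)"
    by (simp only: T1_closed_form)
  finally show ?thesis .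
next
  case False
  then show ?thesis
    by (simp add: numer_def coeff_monom_mult binomial_eq_0)
qed

lemma higher_pderiv_numer_eq_0: "(pderiv ^^ (2 * (a + b + 2))) (numer a b) = 0"
proof -
  have "degree (numer a b) \<le> 2 * a + 1 + (2 * b + 1)"
    unfolding numer_def
    by (intro order.trans[OF degree_smult_le] order.trans[OF degree_mult_le] add_mono
        order.trans[OF degree_power_le] degree_monom_le) simp
  then have "coeff (numer a b) (i + 2 * (a + b + 2)) = 0" for i
    by (intro coeff_eq_0) simp
  then show ?thesis
    by (intro poly_eqI) (simp add: coeff_higher_pderiv del: funpow.simps)
qed

section \<open>The zeta series and its alternating analogue\<close>

lemma zeta_LIMSEQ:
  assumes "2 \<le> s"
  shows "(\<lambda>N. \<Sum>k = 1..N. 1 / real k ^ s) \<longlonglongrightarrow> zeta (real s)"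
proof -
  have "summable (\<lambda>n. inverse (real (Suc n)) ^ s)"
    using inverse_power_summable[OF assms, where 'a = real] summable_Suc_iff[of "\<lambda>n. inverse (real n ^ s)"]
    by (simp add: power_inverse)
  then have "(\<lambda>n. 1 / real (Suc n) ^ s) sums (\<Sum>n. 1 / real (Suc n) ^ s)"
    by (intro summable_sums) (simp add: power_inverse field_simps)
  then show ?thesis
    by (simp add: sums_def zeta_def powr_realpow sum.atLeast1_atMost_eq del: of_nat_Suc)
qed

text \<open>Absolute convergence provides a limit, which is then identified along the partial sums
  of even length.\<close>

lemma alternating_zeta_LIMSEQ:
  assumes "2 \<le> s"
  shows "(\<lambda>N. \<Sum>k = 1..N. (- 1) ^ k / real k ^ s) \<longlonglongrightarrow> (2 / 2 ^ s - 1) * zeta (real s)"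
proof -
  define A where "A = (\<lambda>N. \<Sum>k = 1..N. (- 1) ^ k / real k ^ s)"
  define S where "S = (\<lambda>N. \<Sum>k = 1..N. 1 / real k ^ s)"
  have S: "S \<longlonglongrightarrow> zeta (real s)"
    unfolding S_def by (rule zeta_LIMSEQ[OF assms])
  \<comment> \<open>Adding \<open>S (2 * N)\<close> to \<open>A (2 * N)\<close> cancels the odd
    terms and doubles the even ones.\<close>
  have even: "A (2 * N) = 2 / 2 ^ s * S N - S (2 * N)" for N
  proof (induction N)
    case (Suc N)
    have "2 * Suc N = Suc (Suc (2 * N))"
      by simp
    moreover have "real (Suc (Suc (2 * N))) ^ s = 2 ^ s * real (Suc N) ^ s"
      unfolding power_mult_distrib[symmetric] by (simp add: algebra_simps)
    ultimately show ?case
      using Suc unfolding A_def S_def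
      by (simp add: distrib_left del: of_nat_Suc)
  qed (simp add: A_def S_def)
  have "convergent A"
  proof -
    have "summable (\<lambda>n. 1 / real (Suc n) ^ s)"
      using zeta_LIMSEQ[OF assms]
      by (auto simp: summable_def sums_def sum.atLeast1_atMost_eq)
    then have "summable (\<lambda>n. (- 1) ^ Suc n / real (Suc n) ^ s)"
      by (rule summable_comparison_test'[of _ 0]) (simp add: norm_divide norm_power)
    then show ?thesis
      by (simp add: A_def sum.atLeast1_atMost_eq summable_iff_convergent del: of_nat_Suc power_Suc)
  qed
  then obtain L where L: "A \<longlonglongrightarrow> L"
    by (auto simp: convergent_def)
  have sub: "strict_mono ((*) 2 :: nat \<Rightarrow> nat)"
    by (simp add: strict_mono_def)
  have "(\<lambda>N. 2 / 2 ^ s * S N - S (2 * N)) \<longlonglongrightarrow> 2 / 2 ^ s * zeta (real s) - zeta (real s)"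
    by (intro tendsto_intros S LIMSEQ_subseq_LIMSEQ[OF S sub, unfolded o_def])
  moreover have "(\<lambda>N. 2 / 2 ^ s * S N - S (2 * N)) \<longlonglongrightarrow> L"
    using LIMSEQ_subseq_LIMSEQ[OF L sub] by (simp add: o_def even)
  ultimately have "L = 2 / 2 ^ s * zeta (real s) - zeta (real s)"
    using LIMSEQ_unique by blast
  then have "L = (2 / 2 ^ s - 1) * zeta (real s)"
    by (simp add: left_diff_distrib)
  then show ?thesis
    using L unfolding A_def by simp
qed

section \<open>Assembly of the formula\<close>

theorem theorem1p2:
  fixes a b :: nat
  shows "T2 a b =
    (\<Sum>k = 1..a + b + 1.
       (- 1) ^ (k + 1)
       * (real ((2 * k) choose (2 * a + 1))
          + real ((2 * k) choose (2 * b + 1)) * (1 - 1 / 2 ^ (2 * k)))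
       * (1 / 2 ^ (2 * k))
       * T1 (a + b + 1 - k)
       * zeta (real (2 * k + 1)))"
proof -
  define I where "I = (\<lambda>k. integral {0..pi / 2} (\<lambda>x. poly (numer a b) x * sin (2 * real k * x)))"
  define A where "A = (\<lambda>j. real ((2 * j) choose (2 * a + 1)) * T1 (a + b + 1 - j))"
  define B where "B = (\<lambda>j. real ((2 * j) choose (2 * b + 1)) * T1 (a + b + 1 - j))"
  have at_0: "poly ((pderiv ^^ (2 * j)) (numer a b)) 0 = - A j" if "j \<le> a + b + 1" for j
    unfolding poly_higher_pderiv_0 A_def using that by (rule coeff_numer)
  have at_pi_half: "poly ((pderiv ^^ (2 * j)) (numer a b)) (pi / 2) = - B j" if "j \<le> a + b + 1" for j
  proof -
    have "poly ((pderiv ^^ (2 * j)) (numer a b)) (pi / 2)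
        = poly (pcompose ((pderiv ^^ (2 * j)) (numer a b)) [:pi / 2, - 1:]) 0"
      by (simp add: poly_pcompose)
    also have "\<dots> = poly ((pderiv ^^ (2 * j)) (numer b a)) 0"
      unfolding higher_pderiv_reflect[symmetric] numer_reflect ..
    also have "\<dots> = - B j"
      unfolding poly_higher_pderiv_0 B_def using that coeff_numer[of j b a] by (simp add: add.commute)
    finally show ?thesis .
  qed
  have poly_int: "((\<lambda>x. poly (numer a b) x * sin (2 * real k * x)) has_integral
      (\<Sum>j<a + b + 2. (- 1) ^ j * (- A j + (- 1) ^ k * B j) / (2 * real k) ^ (2 * j + 1))) {0..pi / 2}"
    if "0 < k" for k
  proof -
    have "(\<Sum>j<a + b + 2. (- 1) ^ j * (poly ((pderiv ^^ (2 * j)) (numer a b)) 0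
          - (- 1) ^ k * poly ((pderiv ^^ (2 * j)) (numer a b)) (pi / 2)) / (2 * real k) ^ (2 * j + 1))
        = (\<Sum>j<a + b + 2. (- 1) ^ j * (- A j + (- 1) ^ k * B j) / (2 * real k) ^ (2 * j + 1))"
      by (rule sum.cong) (simp_all add: at_0 at_pi_half)
    then show ?thesis
      using has_integral_poly_sin[OF that higher_pderiv_numer_eq_0[of a b]] by simp
  qed
  have I_sum: "(\<Sum>k = 1..N. 2 * I k) = (\<Sum>j = 1..a + b + 1. (- 1) ^ j / 2 ^ (2 * j) *
      (- A j * (\<Sum>k = 1..N. 1 / real k ^ (2 * j + 1)) + B j * (\<Sum>k = 1..N. (- 1) ^ k / real k ^ (2 * j + 1))))"
    for N
  proof -
    have "2 * I k = (\<Sum>j = 1..a + b + 1. (- 1) ^ j / 2 ^ (2 * j) *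
        (- A j * (1 / real k ^ (2 * j + 1)) + B j * ((- 1) ^ k / real k ^ (2 * j + 1))))"
      if "k \<in> {1..N}" for k
    proof -
      have "2 * I k = (\<Sum>j<a + b + 2. 2 * ((- 1) ^ j * (- A j + (- 1) ^ k * B j) / (2 * real k) ^ (2 * j + 1)))"
        using integral_unique[OF poly_int[of k]] that by (simp add: I_def sum_distrib_left)
      \<comment> \<open>The term \<open>j = 0\<close> is zero because both binomials have upper
        entry 0 and odd lower entry; this keeps the divergent sum of \<open>1 / k\<close> out of the
        limit.\<close>
      also have "\<dots> = (\<Sum>j = 1..a + b + 1. 2 * ((- 1) ^ j * (- A j + (- 1) ^ k * B j) / (2 * real k) ^ (2 * j + 1)))"
        by (rule sum.mono_neutral_right) (auto simp: A_def B_def Suc_le_eq)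
      also have "\<dots> = (\<Sum>j = 1..a + b + 1. (- 1) ^ j / 2 ^ (2 * j) *
        (- A j * (1 / real k ^ (2 * j + 1)) + B j * ((- 1) ^ k / real k ^ (2 * j + 1))))"
        using that by (intro sum.cong refl) (simp add: power_mult_distrib field_simps)
      finally show ?thesis .
    qed
    then have "(\<Sum>k = 1..N. 2 * I k) = (\<Sum>k = 1..N. \<Sum>j = 1..a + b + 1. (- 1) ^ j / 2 ^ (2 * j) *
        (- A j * (1 / real k ^ (2 * j + 1)) + B j * ((- 1) ^ k / real k ^ (2 * j + 1))))"
      by (rule sum.cong[OF refl])
    also have "\<dots> = (\<Sum>j = 1..a + b + 1. \<Sum>k = 1..N. (- 1) ^ j / 2 ^ (2 * j) *
        (- A j * (1 / real k ^ (2 * j + 1)) + B j * ((- 1) ^ k / real k ^ (2 * j + 1))))"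
      by (rule sum.swap)
    finally show ?thesis
      by (simp only: sum_distrib_left[symmetric] sum.distrib)
  qed
  \<comment> \<open>An exact identity for every \<open>N\<close>: the left side is constant, so
    letting \<open>N\<close> grow evaluates \<open>T2 a b\<close>.\<close>
  have split: "T2 a b = (\<Sum>k = 1..N. 2 * I k)
      + integral {0..pi / 2} (\<lambda>x. cot_kernel a b x * cos ((2 * real N + 1) * x))" for N
  proof -
    have "((\<lambda>x. (\<Sum>k = 1..N. 2 * (poly (numer a b) x * sin (2 * real k * x)))
        + cot_kernel a b x * cos ((2 * real N + 1) * x)) has_integral
        (\<Sum>k = 1..N. 2 * I k) + integral {0..pi / 2} (\<lambda>x. cot_kernel a b x * cos ((2 * real N + 1) * x))) {0..pi / 2}"
      unfolding I_def
      by (intro has_integral_add has_integral_sum has_integral_mult_right integrable_integral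
          integrable_continuous_real continuous_intros continuous_on_cot_kernel) auto
    moreover have "(\<Sum>k = 1..N. 2 * (poly (numer a b) x * sin (2 * real k * x)))
        + cot_kernel a b x * cos ((2 * real N + 1) * x) = cot_kernel a b x * cos x" if "x \<in> {0..pi / 2}" for x
    proof -
      have "(\<Sum>k = 1..N. 2 * (poly (numer a b) x * sin (2 * real k * x)))
          = cot_kernel a b x * (sin x * (\<Sum>k = 1..N. 2 * sin (2 * real k * x)))"
        unfolding poly_numer[OF that] sum_distrib_left by (simp add: mult_ac)
      then show ?thesis
        unfolding sin_times_sum_sin by (simp add: algebra_simps)
    qed
    ultimately show ?thesis
      unfolding T2_integral by (intro integral_unique) (rule has_integral_eq[rotated])
  qed
  let ?RHS = "\<Sum>j = 1..a + b + 1. (- 1) ^ j / 2 ^ (2 * j) *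
      (- A j * zeta (real (2 * j + 1)) + B j * ((2 / 2 ^ (2 * j + 1) - 1) * zeta (real (2 * j + 1))))"
  have "(\<lambda>N. \<Sum>k = 1..N. 2 * I k) \<longlonglongrightarrow> ?RHS"
    unfolding I_sum by (intro tendsto_intros zeta_LIMSEQ alternating_zeta_LIMSEQ) auto
  from tendsto_add[OF this cot_kernel_cos_tendsto_0[of a b]] have "(\<lambda>N. T2 a b) \<longlonglongrightarrow> ?RHS"
    by (simp only: split[symmetric] add_0_right)
  then have "T2 a b = ?RHS"
    by (simp add: LIMSEQ_const_iff)
  \<comment> \<open>Here \<open>2 / 2 ^ (2 * j + 1) - 1 = - (1 - 1 / 2 ^ (2 * j))\<close>, so both
    parts carry a minus sign, which turns \<open>(- 1) ^ j\<close> into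
    \<open>(- 1) ^ (k + 1)\<close>.\<close>
  also have "\<dots> = (\<Sum>k = 1..a + b + 1. (- 1) ^ (k + 1)
       * (real ((2 * k) choose (2 * a + 1)) + real ((2 * k) choose (2 * b + 1)) * (1 - 1 / 2 ^ (2 * k)))
       * (1 / 2 ^ (2 * k)) * T1 (a + b + 1 - k) * zeta (real (2 * k + 1)))"
    by (rule sum.cong) (simp_all add: A_def B_def algebra_simps)
  finally show ?thesis .
qed

end
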